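(* Let $m\ge1$ and $n\ge m-1$ be integers. Then $$\prod_{1\le i<j\le m}(1-x_ix_j)\,P_n(x_1,\dots,x_m)=\prod_{i=1}^m\frac{(q^{n+1-m+i};q)_{i-1}}{(-q^{n+1-m+i};q)_{i-1}}\ \det_{1\le i,j\le m}\left(x_i^{j-1}P_{n+m+1-2j}(x_i)\right).$$
   Context: $q$ is a generic complex parameter: $q\neq 0$ and $q$ is not a root of unity. $(a;q)_k=(1-a)(1-aq)\cdots(1-aq^{k-1})$ and $(a_1,\dots,a_r;q)_k=(a_1;q)_k\cdots(a_r;q)_k$. For integers $n\ge 0$, $m\ge1$, $$P_n(x_1,\dots,x_m)=\frac{(-q;q)_n^m}{(q;q)_n^m}\sum_{k_1,\dots,k_m=0}^n\ \prod_{1\le i<j\le m}\frac{q^{k_j}-q^{k_i}}{q^{k_j}+q^{k_i}}\prod_{i=1}^m\frac{(-q,q^{-n};q)_{k_i}}{(q,-q^{-n};q)_{k_i}}\,x_i^{k_i}.$$ In the determinant, $P_{N}(x)$ denotes the one-variable case. *)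

theory Defs
  imports Complex_Main "HOL-Library.FuncSet" "Jordan_Normal_Form.Determinant"
begin

definition qpoch :: "complex \<Rightarrow> complex \<Rightarrow> nat \<Rightarrow> complex" where
  "qpoch a q k = (\<Prod>l<k. 1 - a * q ^ l)"

text \<open>The variables are \<open>x 1, \<dots>, x m\<close>; values of \<open>x\<close> at other indices are irrelevant. If \<open>q\<close> is
  nonzero and not a root of unity, none of the denominators below vanishes.\<close>

definition P :: "complex \<Rightarrow> nat \<Rightarrow> nat \<Rightarrow> (nat \<Rightarrow> complex) \<Rightarrow> complex" where
  "P q m n x =
     qpoch (- q) q n ^ m / qpoch q q n ^ m *
     (\<Sum>k \<in> {1..m} \<rightarrow>\<^sub>E {0..n}.
        (\<Prod>j=1..m. \<Prod>i=1..<j. (q ^ k j - q ^ k i) / (q ^ k j + q ^ k i)) *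
        (\<Prod>i=1..m.
           (qpoch (- q) q (k i) * qpoch (q powi (- int n)) q (k i)) /
           (qpoch q q (k i) * qpoch (- (q powi (- int n))) q (k i)) * x i ^ k i))"

end

theory Submission
  imports Defs
begin

text \<open>
  Put \<open>y i = - x i\<close>. After cancelling the ratios of \<open>q\<close>-shifted factorials, \<open>P\<close> becomes the sum
  \<open>rogers_multi\<close>: Schur's product \<open>\<Prod>i<j. (t j - t i) / (t j + t i)\<close> at \<open>t i = q ^ k i\<close>, weighted in each
  variable by the coefficients of a Rogers polynomial \<open>R n\<close> with parameter \<open>- q\<close>, normalised to be
  an ordinary polynomial in \<open>y\<close>. The determinant then has the entries
  \<open>(- y i) ^ j * R (n + m - 1 - 2 * j) (y i)\<close>, whose span over \<open>j < m\<close> is called \<open>V n m\<close> here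
  (formally, \<open>rogers_space n m\<close>).

  The proof compares both sides as functions of the last variable \<open>z = y m\<close>, the others being fixed.
  The right-hand side lies in \<open>V n m\<close> and vanishes at \<open>z = y i\<close> for \<open>i < m\<close>; in general position these
  two properties determine a function up to a factor. The left-hand side
  \<open>f z = (\<Prod>i<m. 1 - z * y i) * rogers_multi\<close> vanishes at the same points by antisymmetry, so the heart
  of the matter is that \<open>f\<close> lies in \<open>V n m\<close> (\<open>cleared_in_rogers_space\<close>):

  \<^item> The partial fraction expansion of Schur's product (\<open>schur_partial_fractions\<close>) writes the
    multivariate sum as a combination of \<open>R n z\<close> and of two-variable sums in \<open>y i\<close> and \<open>z\<close>. A
    two-variable sum times \<open>1 - z * y i\<close> lies in \<open>V n 2\<close> (\<open>pair_sum_formula\<close>), by an identity of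
    Christoffel-Darboux type. By the three-term recurrence, each further factor \<open>1 - z * y i\<close> maps
    \<open>V n m + (1 - z) V n (m - 1)\<close> into the same space with \<open>m\<close> increased by one. So
    \<open>f z = g z + (1 - z) * h z\<close> with \<open>g\<close> in \<open>V n m\<close> and \<open>h\<close> in \<open>V n (m - 1)\<close>.

  \<^item> The reflection \<open>f z \<mapsto> z ^ (n + m - 1) * f (1 / z)\<close> fixes \<open>g\<close> and negates \<open>(1 - z) * h z\<close>. Since \<open>f\<close>
    vanishes at \<open>y i\<close> by antisymmetry and at \<open>1 / y i\<close> because of the factor \<open>1 - z * y i\<close>, the
    function \<open>h\<close> vanishes at all \<open>m - 1\<close> points \<open>y i\<close>. In general position this forces \<open>h = 0\<close>.

  The factor of proportionality is found at \<open>z = 0\<close>, where both sides reduce to the same theorem with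
  \<open>m - 1\<close> and \<open>n - 1\<close> in place of \<open>m\<close> and \<open>n\<close>: an induction on \<open>m\<close> determines the constant. General
  position is removed at the end, because both sides are polynomials.
\<close>

section \<open>Schur's product and its partial fractions\<close>

text \<open>
  With \<open>u = exp (2 * s)\<close> and \<open>v = exp (2 * t)\<close> this is the hyperbolic tangent of \<open>s - t\<close>. The rational
  identities for \<open>hyp\<close> below are forms of the addition theorem of that function.
\<close>

definition hyp :: "complex \<Rightarrow> complex \<Rightarrow> complex" where
  "hyp u v = (u - v) / (u + v)"

lemma hyp_swap: "hyp u v = - hyp v u"
  unfolding hyp_def by (metis add.commute minus_diff_eq minus_divide_left)

lemma hyp_self [simp]: "hyp u u = 0"
  by (simp add: hyp_def)

lemma hyp_uminus: "hyp (- u) v = inverse (hyp u v)"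
proof -
  have "hyp (- u) v = - (u + v) / - (u - v)"
    unfolding hyp_def by (simp add: algebra_simps)
  then show ?thesis
    unfolding hyp_def by (simp only: minus_divide_divide inverse_divide)
qed

lemma hyp_scale: "c \<noteq> 0 \<Longrightarrow> hyp (c * u) (c * v) = hyp u v"
  unfolding hyp_def by (metis distrib_left mult_divide_mult_cancel_left right_diff_distrib')

text \<open>The index set is arbitrary because the partial fraction expansion deletes arbitrary indices.\<close>

definition schur :: "nat set \<Rightarrow> (nat \<Rightarrow> complex) \<Rightarrow> complex" where
  "schur I t = (\<Prod>j\<in>I. \<Prod>i\<in>{i \<in> I. i < j}. hyp (t j) (t i))"

lemma schur_cong: "(\<And>i. i \<in> I \<Longrightarrow> t i = s i) \<Longrightarrow> schur I t = schur I s"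
  unfolding schur_def by (intro prod.cong) auto

text \<open>
  Each factor that pairs the new index with a larger one occurs in the opposite orientation on the
  right-hand side; this is the origin of all signs in the expansion of Schur's product.
\<close>

lemma schur_insert:
  assumes fin: "finite I" and j: "j \<notin> I"
  shows "schur (insert j I) t = schur I t * ((-1) ^ card {i \<in> I. j < i} * (\<Prod>i\<in>I. hyp (t j) (t i)))"
proof -
  have below: "{i \<in> insert j I. i < j} = {i \<in> I. i < j}" by auto
  have other: "(\<Prod>i\<in>{i \<in> insert j I. i < l}. hyp (t l) (t i)) =
      (if j < l then hyp (t l) (t j) else 1) * (\<Prod>i\<in>{i \<in> I. i < l}. hyp (t l) (t i))"
    if "l \<in> I" for l
  proof (cases "j < l")
    case True
    then have "{i \<in> insert j I. i < l} = insert j {i \<in> I. i < l}" by auto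
    with True fin j show ?thesis by simp
  next
    case False
    then have "{i \<in> insert j I. i < l} = {i \<in> I. i < l}" by auto
    with False show ?thesis by simp
  qed
  have above: "(\<Prod>l\<in>I. if j < l then hyp (t l) (t j) else 1) =
      (-1) ^ card {i \<in> I. j < i} * (\<Prod>i\<in>{i \<in> I. j < i}. hyp (t j) (t i))"
  proof -
    have "(\<Prod>l\<in>I. if j < l then hyp (t l) (t j) else 1) = (\<Prod>l\<in>{i \<in> I. j < i}. hyp (t l) (t j))"
      using fin by (simp add: prod.inter_filter)
    also have "\<dots> = (\<Prod>l\<in>{i \<in> I. j < i}. (-1) * hyp (t j) (t l))"
      by (intro prod.cong refl) (metis hyp_swap mult_minus1)
    also have "\<dots> = (-1) ^ card {i \<in> I. j < i} * (\<Prod>i\<in>{i \<in> I. j < i}. hyp (t j) (t i))"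
      by (simp only: prod.distrib prod_constant)
    finally show ?thesis .
  qed
  have split: "(\<Prod>i\<in>I. hyp (t j) (t i)) =
      (\<Prod>i\<in>{i \<in> I. i < j}. hyp (t j) (t i)) * (\<Prod>i\<in>{i \<in> I. j < i}. hyp (t j) (t i))"
  proof -
    have "I = {i \<in> I. i < j} \<union> {i \<in> I. j < i}"
      using j by (auto simp: not_less_iff_gr_or_eq)
    then show ?thesis
      using fin by (metis (no_types, lifting) finite_Un prod.union_disjoint
          disjoint_iff mem_Collect_eq order_less_asym)
  qed
  have "schur (insert j I) t =
      (\<Prod>i\<in>{i \<in> I. i < j}. hyp (t j) (t i)) * (\<Prod>l\<in>I. \<Prod>i\<in>{i \<in> insert j I. i < l}. hyp (t l) (t i))"
    unfolding schur_def by (subst prod.insert [OF fin j], subst below) (rule refl)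
  also have "(\<Prod>l\<in>I. \<Prod>i\<in>{i \<in> insert j I. i < l}. hyp (t l) (t i)) =
      (\<Prod>l\<in>I. if j < l then hyp (t l) (t j) else 1) * schur I t"
    unfolding schur_def by (subst prod.distrib [symmetric]) (intro prod.cong refl other)
  finally show ?thesis
    by (simp add: above split mult_ac)
qed

text \<open>
  Extracting both indices leaves products over the remaining indices that are exchanged with each
  other, and the single factor \<open>hyp (t a) (t b)\<close>, which changes its sign.
\<close>

lemma schur_swap:
  assumes fin: "finite I" and ab: "a \<in> I" "b \<in> I" "a \<noteq> b"
  shows "schur I (t \<circ> Transposition.transpose a b) = - schur I t"
proof -
  define J where "J = I - {a, b}"
  let ?s = "t \<circ> Transposition.transpose a b"
  have I: "I = insert a (insert b J)" and finJ: "finite J" and notin: "a \<notin> insert b J" "b \<notin> J"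
    using fin ab by (auto simp: J_def)
  have J: "?s i = t i" if "i \<in> J" for i
    using that by (auto simp: J_def)
  have exp: "schur I r = schur J r * ((-1) ^ card {i \<in> J. b < i} * (\<Prod>i\<in>J. hyp (r b) (r i))) *
      ((-1) ^ card {i \<in> insert b J. a < i} * (hyp (r a) (r b) * (\<Prod>i\<in>J. hyp (r a) (r i))))" for r
    unfolding I using finJ notin by (simp add: schur_insert)
  have prods: "(\<Prod>i\<in>J. hyp c (?s i)) = (\<Prod>i\<in>J. hyp c (t i))" for c
    by (intro prod.cong refl) (simp only: J)
  have sJ: "schur J ?s = schur J t"
    by (rule schur_cong) (rule J)
  have ends: "?s a = t b" "?s b = t a" by auto
  show ?thesis
    unfolding exp [of ?s] exp [of t] prods sJ ends hyp_swap [of "t b" "t a"]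
    by simp
qed

text \<open>
  The addition theorem of the hyperbolic tangent, as the partial fraction expansion in \<open>z\<close> of a
  product of two factors.
\<close>

lemma hyp_mult:
  assumes "z + s \<noteq> 0" "z + t \<noteq> 0" "s + t \<noteq> 0" "s \<noteq> t"
  shows "hyp z s * hyp z t = 1 + hyp (- s) t * hyp z s + hyp (- t) s * hyp z t"
proof -
  have "- s + t \<noteq> 0" "- t + s \<noteq> 0" "t + s \<noteq> 0"
    using assms by (auto simp: add.commute)
  have e: "hyp (- s) t = (s + t) / (s - t)" "hyp (- t) s = - ((s + t) / (s - t))"
    unfolding hyp_def using assms(4) by (simp_all add: divide_simps) (auto simp: algebra_simps)
  have diff: "hyp z s - hyp z t = - (2 * z * (s - t)) / ((z + s) * (z + t))"
    unfolding hyp_def using assms by (subst diff_frac_eq) (simp_all add: algebra_simps)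
  have "1 + (s + t) / (s - t) * (hyp z s - hyp z t) =
      ((z + s) * (z + t) - 2 * z * (s + t)) / ((z + s) * (z + t))"
    unfolding diff using assms by (simp add: diff_divide_distrib)
  also have "\<dots> = hyp z s * hyp z t"
    unfolding hyp_def by (simp add: algebra_simps)
  finally have "hyp z s * hyp z t = 1 + (s + t) / (s - t) * (hyp z s - hyp z t)" by simp
  then show ?thesis
    unfolding e by (simp add: right_diff_distrib)
qed

text \<open>
  The product is a rational function of \<open>z\<close>, bounded at infinity, with simple poles at \<open>- t j\<close>, and the
  coefficients are its residues there. Induction gives this without discussing residues: the
  identity \<open>hyp_mult\<close> distributes a new factor over the expansion, and the coefficient of the
  new pole is the expansion of the old product evaluated at that pole.
\<close>

lemma prod_hyp_partial_fractions:
  assumes "finite I" "inj_on t I" "\<And>i j. i \<in> I \<Longrightarrow> j \<in> I \<Longrightarrow> t i + t j \<noteq> 0"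
  shows "\<exists>c. \<forall>z. (\<forall>i\<in>I. z + t i \<noteq> 0) \<longrightarrow>
    (\<Prod>i\<in>I. hyp z (t i)) = c + (\<Sum>j\<in>I. (\<Prod>i\<in>I - {j}. hyp (- t j) (t i)) * hyp z (t j))"
  using assms
proof (induction I rule: finite_induct)
  case empty
  show ?case by auto
next
  case (insert s I)
  define C where "C j = (\<Prod>i\<in>I - {j}. hyp (- t j) (t i))" for j
  have "inj_on t I" using insert.prems(1) by simp
  then have "\<exists>c. \<forall>z. (\<forall>i\<in>I. z + t i \<noteq> 0) \<longrightarrow>
      (\<Prod>i\<in>I. hyp z (t i)) = c + (\<Sum>j\<in>I. C j * hyp z (t j))"
    unfolding C_def by (rule insert.IH) (use insert.prems(2) in simp)
  then obtain c where c:
    "\<And>z. (\<forall>i\<in>I. z + t i \<noteq> 0) \<Longrightarrow> (\<Prod>i\<in>I. hyp z (t i)) = c + (\<Sum>j\<in>I. C j * hyp z (t j))"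
    by blast
  have neq: "t i \<noteq> t s" if "i \<in> I" for i
    using insert.prems(1) insert.hyps(2) that inj_onD [of t "insert s I" i s] by auto
  have at: "(\<Prod>i\<in>I. hyp (- t s) (t i)) = c + (\<Sum>j\<in>I. C j * hyp (- t s) (t j))"
    using neq by (intro c) (auto simp: add_eq_0_iff)
  have C': "(\<Prod>i\<in>insert s I - {j}. hyp (- t j) (t i)) = C j * hyp (- t j) (t s)" if "j \<in> I" for j
  proof -
    have "insert s I - {j} = insert s (I - {j})" using that insert.hyps by auto
    with insert.hyps show ?thesis by (simp add: C_def)
  qed
  show ?case
  proof (intro exI allI impI)
    fix z assume z: "\<forall>i\<in>insert s I. z + t i \<noteq> 0"
    have two: "hyp z (t s) * hyp z (t j) =
        1 + hyp (- t s) (t j) * hyp z (t s) + hyp (- t j) (t s) * hyp z (t j)" if "j \<in> I" for j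
      using z that insert.prems(2) [of s j] neq [OF that] by (intro hyp_mult) auto
    have "(\<Prod>i\<in>insert s I. hyp z (t i)) = hyp z (t s) * (c + (\<Sum>j\<in>I. C j * hyp z (t j)))"
      using insert.hyps z by (simp add: c)
    also have "\<dots> = c * hyp z (t s) + (\<Sum>j\<in>I. C j * (hyp z (t s) * hyp z (t j)))"
      by (simp add: algebra_simps sum_distrib_left)
    also have "(\<Sum>j\<in>I. C j * (hyp z (t s) * hyp z (t j))) =
        (\<Sum>j\<in>I. C j + hyp z (t s) * (C j * hyp (- t s) (t j)) + C j * hyp (- t j) (t s) * hyp z (t j))"
      by (intro sum.cong refl) (simp only: two, simp add: algebra_simps)
    also have "c * hyp z (t s) + \<dots> = sum C I + (c + (\<Sum>j\<in>I. C j * hyp (- t s) (t j))) * hyp z (t s)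
        + (\<Sum>j\<in>I. C j * hyp (- t j) (t s) * hyp z (t j))"
      by (simp add: sum.distrib sum_distrib_left algebra_simps)
    also have "\<dots> = sum C I + (\<Sum>j\<in>insert s I. (\<Prod>i\<in>insert s I - {j}. hyp (- t j) (t i)) * hyp z (t j))"
      using insert.hyps by (simp add: C' flip: at)
    finally show "(\<Prod>i\<in>insert s I. hyp z (t i)) =
      sum C I + (\<Sum>j\<in>insert s I. (\<Prod>i\<in>insert s I - {j}. hyp (- t j) (t i)) * hyp z (t j))" .
  qed
qed

text \<open>
  Up to the summand \<open>c\<close> this is the expansion of Schur's Pfaffian along the row of \<open>z\<close>. It matters
  that the coefficient of the term with \<open>t j\<close> does not depend on \<open>t j\<close>: then summation over
  all \<open>t\<close> separates into a sum over \<open>t j\<close> and a sum over the other nodes. For distinct nodes the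
  coefficients are the residues computed above. If two nodes coincide, then the left-hand side
  vanishes, and on the right-hand side only the two terms that delete one of these nodes survive; they
  differ by a sign.
\<close>

lemma schur_partial_fractions:
  assumes fin: "finite I" and nz: "\<And>i j. i \<in> I \<Longrightarrow> j \<in> I \<Longrightarrow> t i + t j \<noteq> 0"
  shows "\<exists>c. \<forall>z. (\<forall>i\<in>I. z + t i \<noteq> 0) \<longrightarrow>
    schur I t * (\<Prod>i\<in>I. hyp z (t i)) =
    c + (\<Sum>j\<in>I. (-1) ^ card {i \<in> I. j < i} * schur (I - {j}) t * hyp z (t j))"
proof (cases "inj_on t I")
  case True
  obtain c where c: "\<And>z. (\<forall>i\<in>I. z + t i \<noteq> 0) \<Longrightarrow> (\<Prod>i\<in>I. hyp z (t i)) =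
      c + (\<Sum>j\<in>I. (\<Prod>i\<in>I - {j}. hyp (- t j) (t i)) * hyp z (t j))"
    using prod_hyp_partial_fractions [OF fin True nz] by blast
  have res: "schur I t * (\<Prod>i\<in>I - {j}. hyp (- t j) (t i)) =
      (-1) ^ card {i \<in> I. j < i} * schur (I - {j}) t" if "j \<in> I" for j
  proof -
    have "schur I t = schur (I - {j}) t * ((-1) ^ card {i \<in> I - {j}. j < i} *
        (\<Prod>i\<in>I - {j}. hyp (t j) (t i)))"
      using schur_insert [of "I - {j}" j t] fin that by (simp add: insert_absorb)
    moreover have "{i \<in> I - {j}. j < i} = {i \<in> I. j < i}" by auto
    moreover have "(\<Prod>i\<in>I - {j}. hyp (t j) (t i)) * (\<Prod>i\<in>I - {j}. hyp (- t j) (t i)) = 1"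
    proof -
      have "hyp (t j) (t i) * hyp (- t j) (t i) = 1" if "i \<in> I - {j}" for i
      proof -
        have "t j \<noteq> t i" using True \<open>j \<in> I\<close> that by (auto dest: inj_onD)
        then have "hyp (t j) (t i) \<noteq> 0" using nz [of j i] that \<open>j \<in> I\<close> by (simp add: hyp_def)
        then show ?thesis by (simp add: hyp_uminus)
      qed
      then show ?thesis by (simp flip: prod.distrib)
    qed
    ultimately show ?thesis by (simp add: mult_ac)
  qed
  show ?thesis
    by (rule exI [of _ "schur I t * c"])
      (auto simp: c distrib_left sum_distrib_left mult.assoc [symmetric] res)
next
  case False
  then obtain a b where "a \<in> I" "b \<in> I" "a < b" "t a = t b"
    unfolding inj_on_def by (metis linorder_neqE_nat)
  note ab = this
  define J where "J = I - {a, b}"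
  have finJ: "finite J" using fin by (simp add: J_def)
  have zero: "schur K t = 0" if "finite K" "a \<in> K" "b \<in> K" for K
  proof -
    have "schur K t = schur (K - {a}) t * ((-1) ^ card {i \<in> K - {a}. a < i} *
        (\<Prod>i\<in>K - {a}. hyp (t a) (t i)))"
      using schur_insert [of "K - {a}" a t] that by (simp add: insert_absorb)
    moreover have "(\<Prod>i\<in>K - {a}. hyp (t a) (t i)) = 0"
      using that ab by (intro prod_zero) (auto intro!: bexI [of _ b])
    ultimately show ?thesis by simp
  qed
  have sa: "schur (I - {a}) t = schur J t * ((-1) ^ card {i \<in> J. b < i} * (\<Prod>i\<in>J. hyp (t a) (t i)))"
  proof -
    have "I - {a} = insert b J" "b \<notin> J" using ab by (auto simp: J_def)
    with finJ ab show ?thesis by (simp add: schur_insert)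
  qed
  have sb: "schur (I - {b}) t = schur J t * ((-1) ^ card {i \<in> J. a < i} * (\<Prod>i\<in>J. hyp (t a) (t i)))"
  proof -
    have "I - {b} = insert a J" "a \<notin> J" using ab by (auto simp: J_def)
    with finJ ab show ?thesis by (simp add: schur_insert)
  qed
  have ca: "card {i \<in> I. a < i} = Suc (card {i \<in> J. a < i})"
  proof -
    have "{i \<in> I. a < i} = insert b {i \<in> J. a < i}" "b \<notin> {i \<in> J. a < i}"
      using ab by (auto simp: J_def)
    with finJ show ?thesis by simp
  qed
  have cb: "{i \<in> I. b < i} = {i \<in> J. b < i}"
    using ab by (auto simp: J_def)
  have I: "I = insert a (insert b J)" and notin: "a \<notin> insert b J" "b \<notin> J"
    using ab by (auto simp: J_def)
  have "(\<Sum>j\<in>I. (-1) ^ card {i \<in> I. j < i} * schur (I - {j}) t * hyp z (t j)) = 0" for z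
  proof -
    let ?f = "\<lambda>j. (-1) ^ card {i \<in> I. j < i} * schur (I - {j}) t * hyp z (t j)"
    have "sum ?f I = ?f a + (?f b + sum ?f J)"
      by (subst I) (use finJ notin in simp)
    moreover have "sum ?f J = 0"
      using ab fin by (intro sum.neutral) (auto simp: J_def zero)
    moreover have "?f a + ?f b = 0"
      unfolding sa sb ca cb using ab by (simp add: algebra_simps)
    ultimately show ?thesis by simp
  qed
  then show ?thesis
    using zero [OF fin] ab by (intro exI [of _ 0]) simp
qed

section \<open>Rogers polynomials with parameter \<open>- q\<close>\<close>

locale generic_base =
  fixes q :: complex
  assumes q_nonzero: "q \<noteq> 0"
    and q_not_root_of_unity: "\<forall>k\<ge>1. q ^ k \<noteq> 1"
begin

lemma one_minus_power_nonzero: "k \<ge> 1 \<Longrightarrow> 1 - q ^ k \<noteq> 0"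
  using q_not_root_of_unity by auto

lemma one_plus_power_nonzero: "1 + q ^ k \<noteq> 0"
proof
  assume "1 + q ^ k = 0"
  then have k: "q ^ k = -1" by (metis add_eq_0_iff)
  then have "q ^ (2 * k) = 1" by (simp add: power_mult mult.commute [of 2])
  moreover have "k \<noteq> 0" using k by (intro notI) simp
  ultimately show False using q_not_root_of_unity by auto
qed

lemma power_plus_power_nonzero: "q ^ k + q ^ l \<noteq> 0"
proof (induction k l rule: linorder_wlog)
  case (le k l)
  have "q ^ k + q ^ l = q ^ k * (1 + q ^ (l - k))"
    using le by (simp add: distrib_left flip: power_add)
  then show ?case using q_nonzero one_plus_power_nonzero by simp
qed (simp add: add.commute)

definition wt :: "nat \<Rightarrow> complex" where
  "wt k = qpoch (- q) q k / qpoch q q k"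

lemma qpoch_q_nonzero: "qpoch q q k \<noteq> 0"
  using one_minus_power_nonzero [of "Suc l" for l] by (auto simp: qpoch_def)

lemma qpoch_minus_q_nonzero: "qpoch (- q) q k \<noteq> 0"
  using one_plus_power_nonzero [of "Suc l" for l] by (auto simp: qpoch_def)

lemma wt_0 [simp]: "wt 0 = 1"
  by (simp add: wt_def qpoch_def)

lemma wt_nonzero: "wt k \<noteq> 0"
  by (simp add: wt_def qpoch_q_nonzero qpoch_minus_q_nonzero)

text \<open>
  The relations between coefficients are always stated as multiplication by a hyperbolic tangent,
  never by its reciprocal. Tangents vanish at the ends of the summation ranges, so that no
  boundary terms have to be treated separately.
\<close>

lemma wt_Suc: "wt k = wt (Suc k) * hyp 1 (q ^ Suc k)"
  using one_minus_power_nonzero [of "Suc k"] one_plus_power_nonzero [of "Suc k"]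
  by (simp add: wt_def qpoch_def hyp_def divide_simps)

definition rogers_coeff :: "nat \<Rightarrow> nat \<Rightarrow> complex" where
  "rogers_coeff n k = (if k \<le> n then wt k * wt (n - k) else 0)"

text \<open>
  For \<open>y = exp (- 2 * \<i> * \<theta>)\<close> this is \<open>exp (- \<i> * n * \<theta>)\<close> times the continuous \<open>q\<close>-ultraspherical polynomial
  \<open>C n (cos \<theta>; - q | q)\<close>.
\<close>

definition rogers :: "nat \<Rightarrow> complex \<Rightarrow> complex" where
  "rogers n y = (\<Sum>k\<le>n. rogers_coeff n k * y ^ k)"

lemma rogers_0: "rogers n 0 = wt n"
  by (simp add: rogers_def rogers_coeff_def power_0_left if_distrib cong: if_cong)

lemma rogers_coeff_reflect: "k \<le> n \<Longrightarrow> rogers_coeff n (n - k) = rogers_coeff n k"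
  by (simp add: rogers_coeff_def)

lemma rogers_reflect:
  assumes "y \<noteq> 0"
  shows "y ^ n * rogers n (1 / y) = rogers n y"
proof -
  have "y ^ n * rogers n (1 / y) = (\<Sum>k\<le>n. rogers_coeff n k * y ^ (n - k))"
    unfolding rogers_def sum_distrib_left
    using assms by (intro sum.cong refl) (simp add: power_diff power_one_over divide_simps)
  also have "\<dots> = (\<Sum>k\<le>n. rogers_coeff n k * y ^ k)"
    by (rule sum.reindex_bij_witness [of _ "\<lambda>k. n - k" "\<lambda>k. n - k"]) (auto simp: rogers_coeff_reflect)
  finally show ?thesis by (simp add: rogers_def)
qed

text \<open>
  Any two neighbouring families of coefficients differ by tangents, so every relation between Rogers
  polynomials of degrees \<open>n\<close>, \<open>n + 1\<close> and \<open>n + 2\<close> can be checked coefficientwise relative to the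
  coefficients of the one of highest degree.
\<close>

lemma rogers_coeff_drop_top: "k \<le> Suc n \<Longrightarrow> rogers_coeff n k = rogers_coeff (Suc n) k * hyp (q ^ k) (q ^ Suc n)"
proof (cases "k \<le> n")
  case True
  then have "Suc n - k = Suc (n - k)" by simp
  moreover have "q ^ Suc n = q ^ k * q ^ Suc (n - k)" using True by (simp flip: power_add)
  then have "hyp (q ^ k) (q ^ Suc n) = hyp (q ^ k * 1) (q ^ k * q ^ Suc (n - k))" by (simp only: mult_1_right)
  then have "hyp (q ^ k) (q ^ Suc n) = hyp 1 (q ^ Suc (n - k))"
    using q_nonzero by (simp only: hyp_scale power_not_zero not_False_eq_True)
  ultimately show ?thesis using True wt_Suc [of "n - k"] by (simp add: rogers_coeff_def)
next
  case False
  assume "k \<le> Suc n"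
  with False have "k = Suc n" by simp
  then show ?thesis by (simp add: rogers_coeff_def)
qed

lemma rogers_coeff_drop_bottom: "rogers_coeff n k = rogers_coeff (Suc n) (Suc k) * hyp 1 (q ^ Suc k)"
  using wt_Suc [of k] by (simp add: rogers_coeff_def)

lemma rogers_ext: "rogers n y = (\<Sum>k\<le>Suc n. rogers_coeff n k * y ^ k)"
  by (simp add: rogers_def rogers_coeff_def)

lemma rogers_shift: "y * rogers n y =
    (\<Sum>k\<le>Suc n. rogers_coeff (Suc n) k * hyp 1 (q ^ k) * y ^ k)"
proof -
  have "y * rogers n y = (\<Sum>k\<le>n. rogers_coeff (Suc n) (Suc k) * hyp 1 (q ^ Suc k) * y ^ Suc k)"
    unfolding rogers_def sum_distrib_left
    by (intro sum.cong refl) (simp add: rogers_coeff_drop_bottom [of n] mult_ac)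
  then show ?thesis
    by (subst sum.atMost_Suc_shift) simp
qed

lemma rogers_top: "rogers n y = (\<Sum>k\<le>Suc n. rogers_coeff (Suc n) k * hyp (q ^ k) (q ^ Suc n) * y ^ k)"
  unfolding rogers_ext by (intro sum.cong refl) (simp only: rogers_coeff_drop_top [of _ n] atMost_iff)

lemma rogers_shift_middle: "y * rogers n y =
    (\<Sum>k\<le>Suc (Suc n). rogers_coeff (Suc (Suc n)) k * hyp 1 (q ^ k) * hyp (q ^ k) (q ^ Suc (Suc n)) * y ^ k)"
proof -
  have *: "rogers_coeff (Suc n) k = rogers_coeff (Suc (Suc n)) k * hyp (q ^ k) (q ^ Suc (Suc n))" if "k \<le> Suc n" for k
    using that by (intro rogers_coeff_drop_top) simp
  show ?thesis
    unfolding rogers_shift by (simp add: * mult_ac)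
qed

lemma hyp_add: "1 + u \<noteq> 0 \<Longrightarrow> u + w \<noteq> 0 \<Longrightarrow> 1 + w \<noteq> 0 \<Longrightarrow>
    hyp 1 u + hyp u w = hyp 1 w * (1 + hyp 1 u * hyp u w)"
proof -
  assume nz: "1 + u \<noteq> 0" "u + w \<noteq> 0" "1 + w \<noteq> 0"
  have "hyp 1 u + hyp u w = 2 * u * (1 - w) / ((1 + u) * (u + w))"
    unfolding hyp_def using nz by (simp add: add_frac_eq) (simp add: algebra_simps)
  moreover have "1 + hyp 1 u * hyp u w = 2 * u * (1 + w) / ((1 + u) * (u + w))"
    unfolding hyp_def using nz by (simp add: add_divide_eq_iff add_frac_eq divide_simps) (simp add: algebra_simps)
  ultimately show ?thesis
    unfolding hyp_def using nz by simp
qed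

text \<open>
  Relative to the coefficients of highest degree, the three-term recurrence is the addition theorem
  \<open>hyp_add\<close>.
\<close>

lemma rogers_recurrence:
  "(1 + y) * rogers (Suc n) y = hyp 1 (q ^ Suc (Suc n)) * (rogers (Suc (Suc n)) y + y * rogers n y)"
proof -
  let ?N = "Suc (Suc n)"
  have nz: "1 + q ^ k \<noteq> 0" "q ^ k + q ^ l \<noteq> 0" for k l
    by (rule one_plus_power_nonzero power_plus_power_nonzero)+
  have "(1 + y) * rogers (Suc n) y = rogers (Suc n) y + y * rogers (Suc n) y"
    by (simp add: distrib_right)
  also have "\<dots> = (\<Sum>k\<le>?N. rogers_coeff ?N k * (hyp 1 (q ^ k) + hyp (q ^ k) (q ^ ?N)) * y ^ k)"
    unfolding rogers_shift unfolding rogers_top [of "Suc n"]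
    by (simp only: sum.distrib [symmetric]) (intro sum.cong refl, simp add: algebra_simps)
  also have "\<dots> = (\<Sum>k\<le>?N. hyp 1 (q ^ ?N) * (rogers_coeff ?N k * y ^ k +
      rogers_coeff ?N k * hyp 1 (q ^ k) * hyp (q ^ k) (q ^ ?N) * y ^ k))"
    by (intro sum.cong refl) (simp only: hyp_add [OF nz(1) nz(2) nz(1)], simp add: algebra_simps)
  also have "\<dots> = hyp 1 (q ^ ?N) * (rogers ?N y + y * rogers n y)"
    unfolding rogers_shift_middle unfolding rogers_def by (simp only: sum.distrib sum_distrib_left distrib_left)
  finally show ?thesis .
qed

definition pair_sum :: "nat \<Rightarrow> complex \<Rightarrow> complex \<Rightarrow> complex" where
  "pair_sum n w y = (\<Sum>u\<le>n. \<Sum>v\<le>n. hyp (q ^ v) (q ^ u) * rogers_coeff n u * rogers_coeff n v * w ^ u * y ^ v)"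

text \<open>
  The coefficientwise form of the formula for the two-variable sum. Both bracketed differences
  factor, with the common factor \<open>u * v - w\<close>.
\<close>

lemma hyp_pair:
  assumes nz: "u + v \<noteq> 0" "1 + u \<noteq> 0" "1 + v \<noteq> 0" "u + w \<noteq> 0" "v + w \<noteq> 0" "1 + w \<noteq> 0"
  shows "hyp v u * (hyp u w * hyp v w - hyp 1 u * hyp 1 v) =
    hyp 1 w * (hyp 1 u * hyp u w - hyp 1 v * hyp v w)"
proof -
  have L: "hyp u w * hyp v w - hyp 1 u * hyp 1 v =
      2 * (1 - w) * (u + v) * (u * v - w) / ((1 + u) * (1 + v) * (u + w) * (v + w))"
    unfolding hyp_def times_divide_times_eq using nz
    by (subst diff_frac_eq) (simp_all, simp add: divide_simps, simp add: algebra_simps)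
  have R: "hyp 1 u * hyp u w - hyp 1 v * hyp v w =
      2 * (1 + w) * (v - u) * (u * v - w) / ((1 + u) * (1 + v) * (u + w) * (v + w))"
    unfolding hyp_def times_divide_times_eq using nz
    by (subst diff_frac_eq) (simp_all, simp add: divide_simps, simp add: algebra_simps)
  have "hyp v u * (u + v) = v - u" "hyp 1 w * (1 + w) = 1 - w"
    unfolding hyp_def using nz by (simp_all add: add.commute [of v u])
  then show ?thesis
    unfolding L R times_divide_eq_right
    by (intro arg_cong2 [of _ _ _ _ "(/)"] refl) (metis (no_types, lifting) mult.assoc mult.commute)
qed

text \<open>
  A formula of Christoffel-Darboux type, which settles the case of two variables.
\<close>

lemma pair_sum_formula:
  "(1 - w * y) * pair_sum (Suc n) w y =
    hyp 1 (q ^ Suc (Suc n)) * (w * rogers n w * rogers (Suc (Suc n)) y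
      - rogers (Suc (Suc n)) w * (y * rogers n y))"
proof -
  let ?N = "Suc (Suc n)"
  let ?h = "\<lambda>u v. hyp (q ^ v) (q ^ u)"
  have nz: "1 + q ^ k \<noteq> 0" "q ^ k + q ^ l \<noteq> 0" for k l
    by (rule one_plus_power_nonzero power_plus_power_nonzero)+
  have one: "pair_sum (Suc n) w y = (\<Sum>u\<le>?N. \<Sum>v\<le>?N. ?h u v * rogers_coeff (Suc n) u * rogers_coeff (Suc n) v * w ^ u * y ^ v)"
    unfolding pair_sum_def by (simp add: rogers_coeff_def)
  have two: "w * y * pair_sum (Suc n) w y = (\<Sum>u\<le>?N. \<Sum>v\<le>?N. ?h u v *
      (rogers_coeff ?N u * hyp 1 (q ^ u)) * (rogers_coeff ?N v * hyp 1 (q ^ v)) * w ^ u * y ^ v)"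
  proof -
    have sh: "hyp (q ^ Suc v) (q ^ Suc u) = hyp (q ^ v) (q ^ u)" for u v
      using hyp_scale [of q "q ^ v" "q ^ u"] q_nonzero by simp
    have "w * y * pair_sum (Suc n) w y = (\<Sum>u\<le>Suc n. \<Sum>v\<le>Suc n. hyp (q ^ Suc v) (q ^ Suc u) *
      (rogers_coeff ?N (Suc u) * hyp 1 (q ^ Suc u)) * (rogers_coeff ?N (Suc v) * hyp 1 (q ^ Suc v)) * w ^ Suc u * y ^ Suc v)"
      unfolding pair_sum_def sum_distrib_left sh rogers_coeff_drop_bottom [symmetric]
      by (intro sum.cong refl) (simp add: mult_ac)
    also have "\<dots> = (\<Sum>u\<le>?N. \<Sum>v\<le>?N. ?h u v *
      (rogers_coeff ?N u * hyp 1 (q ^ u)) * (rogers_coeff ?N v * hyp 1 (q ^ v)) * w ^ u * y ^ v)"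
      by (subst (2) sum.atMost_Suc_shift, subst (3) sum.atMost_Suc_shift) simp
    finally show ?thesis .
  qed
  have top: "rogers_coeff (Suc n) k = rogers_coeff ?N k * hyp (q ^ k) (q ^ ?N)" if "k \<le> ?N" for k
    using that by (rule rogers_coeff_drop_top)
  have "(1 - w * y) * pair_sum (Suc n) w y = pair_sum (Suc n) w y - w * y * pair_sum (Suc n) w y"
    by (simp add: left_diff_distrib)
  also have "\<dots> = (\<Sum>u\<le>?N. \<Sum>v\<le>?N. rogers_coeff ?N u * rogers_coeff ?N v * w ^ u * y ^ v * (?h u v *
      (hyp (q ^ u) (q ^ ?N) * hyp (q ^ v) (q ^ ?N) - hyp 1 (q ^ u) * hyp 1 (q ^ v))))"
    unfolding two unfolding one sum_subtractf [symmetric]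
    by (intro sum.cong refl) (simp add: top right_diff_distrib mult_ac del: power_Suc)
  also have "\<dots> = (\<Sum>u\<le>?N. \<Sum>v\<le>?N. hyp 1 (q ^ ?N) *
      ((rogers_coeff ?N u * hyp 1 (q ^ u) * hyp (q ^ u) (q ^ ?N) * w ^ u) * (rogers_coeff ?N v * y ^ v)
      - (rogers_coeff ?N u * w ^ u) * (rogers_coeff ?N v * hyp 1 (q ^ v) * hyp (q ^ v) (q ^ ?N) * y ^ v)))"
    by (intro sum.cong refl)
      (simp only: hyp_pair [OF nz(2) nz(1) nz(1) nz(2) nz(2) nz(1)], simp add: right_diff_distrib mult_ac del: power_Suc)
  also have "\<dots> = hyp 1 (q ^ ?N) * (w * rogers n w * rogers ?N y - rogers ?N w * (y * rogers n y))"
    unfolding rogers_shift_middle unfolding rogers_def sum_product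
    by (simp only: sum_distrib_left sum_subtractf right_diff_distrib)
  finally show ?thesis .
qed

section \<open>The span of the entries of a row of the determinant\<close>

definition rogers_basis :: "nat \<Rightarrow> nat \<Rightarrow> nat \<Rightarrow> complex \<Rightarrow> complex" where
  "rogers_basis n m j y = (- y) ^ j * rogers (n + m - 1 - 2 * j) y"

definition rogers_space :: "nat \<Rightarrow> nat \<Rightarrow> (complex \<Rightarrow> complex) set" where
  "rogers_space n m = {f. \<exists>c. \<forall>y. f y = (\<Sum>j<m. c j * rogers_basis n m j y)}"

lemma rogers_spaceI: "(\<And>y. f y = (\<Sum>j<m. c j * rogers_basis n m j y)) \<Longrightarrow> f \<in> rogers_space n m"
  unfolding rogers_space_def by blast

lemma rogers_spaceE:
  assumes "f \<in> rogers_space n m"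
  obtains c where "\<And>y. f y = (\<Sum>j<m. c j * rogers_basis n m j y)"
  using assms unfolding rogers_space_def by blast

lemma rogers_space_add: "f \<in> rogers_space n m \<Longrightarrow> g \<in> rogers_space n m \<Longrightarrow> (\<lambda>y. f y + g y) \<in> rogers_space n m"
  by (elim rogers_spaceE, rule_tac c = "\<lambda>j. c j + ca j" in rogers_spaceI) (simp add: distrib_right sum.distrib)

lemma rogers_space_scale: "f \<in> rogers_space n m \<Longrightarrow> (\<lambda>y. a * f y) \<in> rogers_space n m"
  by (elim rogers_spaceE, rule_tac c = "\<lambda>j. a * c j" in rogers_spaceI) (simp add: sum_distrib_left mult.assoc)

lemma rogers_space_zero: "(\<lambda>y. 0) \<in> rogers_space n m"
  by (rule rogers_spaceI [where c = "\<lambda>_. 0"]) simp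

lemma rogers_space_basis: "j < m \<Longrightarrow> rogers_basis n m j \<in> rogers_space n m"
  by (rule rogers_spaceI [where c = "\<lambda>i. if i = j then 1 else 0"]) (simp add: if_distrib [of "\<lambda>u. u * _"] cong: if_cong)

lemma rogers_space_sum: "(\<And>j. j \<in> J \<Longrightarrow> f j \<in> rogers_space n m) \<Longrightarrow> (\<lambda>y. \<Sum>j\<in>J. f j y) \<in> rogers_space n m"
  by (induction J rule: infinite_finite_induct) (auto intro: rogers_space_zero rogers_space_add)

lemma rogers_space_mult_var:
  assumes "f \<in> rogers_space n m"
  shows "(\<lambda>y. y * f y) \<in> rogers_space n (Suc (Suc m))"
proof -
  obtain c where c: "\<And>y. f y = (\<Sum>j<m. c j * rogers_basis n m j y)"
    using assms by (rule rogers_spaceE) blast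
  have "y * rogers_basis n m j y = - rogers_basis n (Suc (Suc m)) (Suc j) y" if "j < m" for j y
    using that by (simp add: rogers_basis_def mult.assoc)
  then have "y * f y = (\<Sum>j<m. - c j * rogers_basis n (Suc (Suc m)) (Suc j) y)" for y
    unfolding c sum_distrib_left by (intro sum.cong refl) (simp add: mult.left_commute [of y])
  moreover have "(\<lambda>y. \<Sum>j<m. - c j * rogers_basis n (Suc (Suc m)) (Suc j) y) \<in> rogers_space n (Suc (Suc m))"
    by (intro rogers_space_sum rogers_space_scale rogers_space_basis) simp
  ultimately show ?thesis by simp
qed

text \<open>The three-term recurrence expresses \<open>1 + y\<close> times a basis function by two neighbouring ones.\<close>

lemma rogers_space_mult_one_plus:
  assumes "f \<in> rogers_space n m" "m \<le> n"
  shows "(\<lambda>y. (1 + y) * f y) \<in> rogers_space n (Suc m)"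
proof -
  obtain c where c: "\<And>y. f y = (\<Sum>j<m. c j * rogers_basis n m j y)"
    using assms(1) by (rule rogers_spaceE) blast
  have "(1 + y) * rogers_basis n m j y = hyp 1 (q ^ (n + m - 2 * j)) *
      (rogers_basis n (Suc m) j y - rogers_basis n (Suc m) (Suc j) y)" if "j < m" for j y
  proof -
    \<comment> \<open>The subtraction is exact because of \<open>j < m \<le> n\<close>.\<close>
    define M where "M = n + m - 2 - 2 * j"
    have M: "n + m - 1 - 2 * j = Suc M" "n + Suc m - 1 - 2 * j = Suc (Suc M)"
      "n + Suc m - 1 - 2 * Suc j = M" "n + m - 2 * j = Suc (Suc M)"
      using that assms(2) by (simp_all add: M_def)
    have "(1 + y) * rogers_basis n m j y = (- y) ^ j * ((1 + y) * rogers (Suc M) y)"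
      unfolding rogers_basis_def M by (simp add: mult_ac)
    also have "\<dots> = hyp 1 (q ^ Suc (Suc M)) * (rogers_basis n (Suc m) j y - rogers_basis n (Suc m) (Suc j) y)"
      unfolding rogers_recurrence rogers_basis_def M by (simp add: algebra_simps del: power_Suc) simp
    finally show ?thesis unfolding M .
  qed
  then have "(1 + y) * f y = (\<Sum>j<m. c j * (hyp 1 (q ^ (n + m - 2 * j)) *
      (rogers_basis n (Suc m) j y + (-1) * rogers_basis n (Suc m) (Suc j) y)))" for y
    unfolding c sum_distrib_left by (intro sum.cong refl) (simp add: mult.left_commute [of "1 + y"])
  moreover have "(\<lambda>y. \<Sum>j<m. c j * (hyp 1 (q ^ (n + m - 2 * j)) *
      (rogers_basis n (Suc m) j y + (-1) * rogers_basis n (Suc m) (Suc j) y))) \<in> rogers_space n (Suc m)"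
    by (intro rogers_space_sum rogers_space_scale rogers_space_add rogers_space_basis) simp_all
  ultimately show ?thesis by simp
qed

text \<open>
  The symmetry of the coefficients of a Rogers polynomial. All basis functions have the same centre
  of symmetry, because multiplication by \<open>y\<close> goes along with lowering the degree by two.
\<close>

lemma rogers_space_reflect:
  assumes "f \<in> rogers_space n m" "m \<le> Suc n" "y \<noteq> 0"
  shows "y ^ (n + m - 1) * f (1 / y) = f y"
proof -
  obtain c where c: "\<And>y. f y = (\<Sum>j<m. c j * rogers_basis n m j y)"
    using assms(1) by (rule rogers_spaceE) blast
  have "y ^ (n + m - 1) * rogers_basis n m j (1 / y) = rogers_basis n m j y" if "j < m" for j
  proof -
    define M where "M = n + m - 1 - 2 * j"
    have M: "n + m - 1 = M + (j + j)" using that assms(2) by (simp add: M_def)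
    have j: "y ^ j * (- (1 / y)) ^ j = (-1) ^ j"
      using assms(3) by (simp flip: power_mult_distrib)
    have "y ^ (n + m - 1) * rogers_basis n m j (1 / y) =
        (y ^ j * (- (1 / y)) ^ j) * y ^ j * (y ^ M * rogers M (1 / y))"
      unfolding rogers_basis_def M_def [symmetric] unfolding M power_add by (simp only: mult_ac)
    also have "\<dots> = rogers_basis n m j y"
      unfolding j rogers_reflect [OF assms(3)] rogers_basis_def M_def [symmetric]
      by (simp flip: power_mult_distrib)
    finally show ?thesis .
  qed
  then show ?thesis
    unfolding c sum_distrib_left by (intro sum.cong refl) (simp add: mult.left_commute [of "y ^ _"])
qed

text \<open>
  The space \<open>rogers_space n m\<close> enlarged by functions on which the reflection acts as \<open>- 1\<close>. Unlike
  \<open>rogers_space\<close>, these spaces are compatible with multiplication by arbitrary linear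
  polynomials.
\<close>

definition ext_space :: "nat \<Rightarrow> nat \<Rightarrow> (complex \<Rightarrow> complex) set" where
  "ext_space n m = {f. \<exists>g\<in>rogers_space n m. \<exists>h\<in>rogers_space n (m - 1). \<forall>y. f y = g y + (1 - y) * h y}"

lemma ext_spaceI: "g \<in> rogers_space n m \<Longrightarrow> h \<in> rogers_space n (m - 1) \<Longrightarrow> (\<And>y. f y = g y + (1 - y) * h y) \<Longrightarrow> f \<in> ext_space n m"
  unfolding ext_space_def by blast

lemma ext_spaceE:
  assumes "f \<in> ext_space n m"
  obtains g h where "g \<in> rogers_space n m" "h \<in> rogers_space n (m - 1)" "\<And>y. f y = g y + (1 - y) * h y"
  using assms unfolding ext_space_def by blast

lemma rogers_space_subset_ext_space: "f \<in> rogers_space n m \<Longrightarrow> f \<in> ext_space n m"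
  by (rule ext_spaceI [OF _ rogers_space_zero]) auto

lemma ext_space_add: "f \<in> ext_space n m \<Longrightarrow> g \<in> ext_space n m \<Longrightarrow> (\<lambda>y. f y + g y) \<in> ext_space n m"
  by (elim ext_spaceE, rule ext_spaceI [OF rogers_space_add rogers_space_add], assumption+) (simp add: algebra_simps)

lemma ext_space_scale:
  assumes "f \<in> ext_space n m"
  shows "(\<lambda>y. a * f y) \<in> ext_space n m"
  using assms
proof (elim ext_spaceE)
  fix g h assume gh: "g \<in> rogers_space n m" "h \<in> rogers_space n (m - 1)" and f: "\<And>y. f y = g y + (1 - y) * h y"
  show ?thesis
    by (rule ext_spaceI [OF rogers_space_scale [OF gh(1)] rogers_space_scale [OF gh(2)], of _ a a]) (simp add: f distrib_left mult.left_commute [of a])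
qed

lemma ext_space_sum: "(\<And>j. j \<in> J \<Longrightarrow> f j \<in> ext_space n m) \<Longrightarrow> (\<lambda>y. \<Sum>j\<in>J. f j y) \<in> ext_space n m"
  by (induction J rule: infinite_finite_induct) (auto intro: rogers_space_subset_ext_space rogers_space_zero ext_space_add)

text \<open>
  A linear polynomial is a combination of \<open>1 + y\<close> and \<open>1 - y\<close>. The only product that does not visibly
  stay in the required form is \<open>(1 - y)\<^sup>2 * h y\<close>, and \<open>(1 - y)\<^sup>2 = (1 + y)\<^sup>2 - 4 * y\<close>.
\<close>

lemma ext_space_mult_linear:
  assumes "f \<in> ext_space n m" "1 \<le> m" "m \<le> n"
  shows "(\<lambda>y. (1 - y * w) * f y) \<in> ext_space n (Suc m)"
proof -
  obtain g h where g: "g \<in> rogers_space n m" and h: "h \<in> rogers_space n (m - 1)"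
    and f: "\<And>y. f y = g y + (1 - y) * h y"
    using assms(1) by (rule ext_spaceE) blast
  define s t where "s = (1 - w) / 2" and "t = (1 + w) / 2"
  have m: "Suc (m - 1) = m" using assms by simp
  have h1: "(\<lambda>y. (1 + y) * h y) \<in> rogers_space n m"
    using rogers_space_mult_one_plus [OF h] assms m by simp
  have h2: "(\<lambda>y. y * h y) \<in> rogers_space n (Suc m)"
    using rogers_space_mult_var [OF h] m by simp
  have h3: "(\<lambda>y. (1 + y) * ((1 + y) * h y)) \<in> rogers_space n (Suc m)"
    by (rule rogers_space_mult_one_plus [OF h1]) fact
  have g1: "(\<lambda>y. (1 + y) * g y) \<in> rogers_space n (Suc m)"
    by (rule rogers_space_mult_one_plus [OF g]) fact
  have st: "1 - y * w = s * (1 + y) + t * (1 - y)" for y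
    by (simp add: s_def t_def field_simps)
  show ?thesis
  proof (rule ext_spaceI)
    show "(\<lambda>y. s * ((1 + y) * g y) + t * ((1 + y) * ((1 + y) * h y) + (- 4) * (y * h y))) \<in> rogers_space n (Suc m)"
      by (intro rogers_space_add rogers_space_scale g1 h2 h3)
    show "(\<lambda>y. s * ((1 + y) * h y) + t * g y) \<in> rogers_space n (Suc m - 1)"
      using m by (simp, intro rogers_space_add rogers_space_scale h1 g)
    show "(1 - y * w) * f y =
      s * ((1 + y) * g y) + t * ((1 + y) * ((1 + y) * h y) + (- 4) * (y * h y)) +
      (1 - y) * (s * ((1 + y) * h y) + t * g y)" for y
      unfolding st f by (simp add: algebra_simps)
  qed
qed

lemma ext_space_mult_prod:
  assumes "finite J" "f \<in> ext_space n m" "1 \<le> m" "m + card J \<le> Suc n"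
  shows "(\<lambda>y. (\<Prod>j\<in>J. 1 - y * w j) * f y) \<in> ext_space n (m + card J)"
  using assms(1,4)
proof (induction J rule: finite_induct)
  case empty
  then show ?case using assms by simp
next
  case (insert j J)
  then have "(\<lambda>y. (\<Prod>j\<in>J. 1 - y * w j) * f y) \<in> ext_space n (m + card J)" by simp
  from ext_space_mult_linear [OF this, of "w j"] insert assms(3) show ?case
    by (simp add: mult.assoc)
qed

end

section \<open>The multivariate sum\<close>

lemma sum_PiE_insert:
  fixes F :: "(nat \<Rightarrow> 'a) \<Rightarrow> 'b::comm_monoid_add"
  assumes "j \<notin> I"
  shows "(\<Sum>k\<in>insert j I \<rightarrow>\<^sub>E A. F k) = (\<Sum>v\<in>A. \<Sum>k\<in>I \<rightarrow>\<^sub>E A. F (k(j := v)))"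
  unfolding PiE_insert_eq
  by (subst sum.reindex [OF inj_combinator [OF assms]]) (simp add: sum.cartesian_product case_prod_beta)

context generic_base
begin

definition rogers_multi :: "nat set \<Rightarrow> nat \<Rightarrow> (nat \<Rightarrow> complex) \<Rightarrow> complex" where
  "rogers_multi I n y = (\<Sum>k\<in>I \<rightarrow>\<^sub>E {0..n}. schur I (\<lambda>i. q ^ k i) * (\<Prod>i\<in>I. rogers_coeff n (k i) * y i ^ k i))"

lemma rogers_multi_cong: "(\<And>i. i \<in> I \<Longrightarrow> y i = z i) \<Longrightarrow> rogers_multi I n y = rogers_multi I n z"
  unfolding rogers_multi_def by (intro sum.cong refl arg_cong2 [of _ _ _ _ "(*)"] prod.cong) auto

lemma rogers_multi_insert:
  assumes fin: "finite I" and j: "j \<notin> I"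
  shows "rogers_multi (insert j I) n y = (\<Sum>v=0..n. \<Sum>k\<in>I \<rightarrow>\<^sub>E {0..n}.
    schur I (\<lambda>i. q ^ k i) * ((-1) ^ card {i \<in> I. j < i} * (\<Prod>i\<in>I. hyp (q ^ v) (q ^ k i))) *
    (rogers_coeff n v * y j ^ v * (\<Prod>i\<in>I. rogers_coeff n (k i) * y i ^ k i)))"
proof -
  have s: "schur I (\<lambda>i. q ^ (k(j := v)) i) = schur I (\<lambda>i. q ^ k i)" for k v
    by (rule schur_cong) (use j in auto)
  have p: "(\<Prod>i\<in>I. f i ((k(j := v)) i)) = (\<Prod>i\<in>I. f i (k i))"
    for k and v :: nat and f :: "nat \<Rightarrow> nat \<Rightarrow> complex"
    by (rule prod.cong) (use j in auto)
  show ?thesis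
    unfolding rogers_multi_def sum_PiE_insert [OF j] schur_insert [OF fin j] prod.insert [OF fin j] s
      p [of "\<lambda>i l. rogers_coeff n l * y i ^ l"] p [of "\<lambda>i l. hyp (q ^ _) (q ^ l)"]
    by (intro sum.cong refl) simp
qed

text \<open>
  For each tuple of the other summation indices, Schur's product is expanded in partial fractions with
  respect to the index \<open>v\<close> of the last variable. In the term with pole at \<open>- q ^ k j\<close>, the sum over \<open>v\<close>
  and \<open>k j\<close> is a two-variable sum, and the remaining sum depends only on the other variables.
\<close>

lemma rogers_multi_decomposition:
  assumes fin: "finite I" and j0: "\<And>i. i \<in> I \<Longrightarrow> i < j0"
  shows "\<exists>c d. \<forall>z. rogers_multi (insert j0 I) n (y(j0 := z)) = c * rogers n z + (\<Sum>j\<in>I. d j * pair_sum n (y j) z)"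
proof -
  let ?K = "I \<rightarrow>\<^sub>E {0..n}"
  define e where "e j = ((-1) ^ card {i \<in> I. j < i} :: complex)" for j
  define W where "W J k = (\<Prod>i\<in>J. rogers_coeff n (k i) * y i ^ k i)" for J k
  have "\<exists>c. \<forall>v. schur I (\<lambda>i. q ^ k i) * (\<Prod>i\<in>I. hyp (q ^ v) (q ^ k i)) =
      c + (\<Sum>j\<in>I. e j * schur (I - {j}) (\<lambda>i. q ^ k i) * hyp (q ^ v) (q ^ k j))" for k
  proof -
    from schur_partial_fractions [OF fin, of "\<lambda>i. q ^ k i"] power_plus_power_nonzero
    obtain c where "\<And>z. (\<forall>i\<in>I. z + q ^ k i \<noteq> 0) \<Longrightarrow>
      schur I (\<lambda>i. q ^ k i) * (\<Prod>i\<in>I. hyp z (q ^ k i)) =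
      c + (\<Sum>j\<in>I. e j * schur (I - {j}) (\<lambda>i. q ^ k i) * hyp z (q ^ k j))"
      unfolding e_def by blast
    with power_plus_power_nonzero show ?thesis by blast
  qed
  then have "\<exists>C. \<forall>k v. schur I (\<lambda>i. q ^ k i) * (\<Prod>i\<in>I. hyp (q ^ v) (q ^ k i)) =
      C k + (\<Sum>j\<in>I. e j * schur (I - {j}) (\<lambda>i. q ^ k i) * hyp (q ^ v) (q ^ k j))"
    by (intro choice allI)
  then obtain C where C: "\<And>k v. schur I (\<lambda>i. q ^ k i) * (\<Prod>i\<in>I. hyp (q ^ v) (q ^ k i)) =
      C k + (\<Sum>j\<in>I. e j * schur (I - {j}) (\<lambda>i. q ^ k i) * hyp (q ^ v) (q ^ k j))"
    by blast
  have notin: "j0 \<notin> I" using j0 by auto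
  have none: "{i \<in> I. j0 < i} = {}" using j0 order_less_asym by blast
  have split: "(\<Sum>v=0..n. \<Sum>k\<in>?K. schur (I - {j}) (\<lambda>i. q ^ k i) * hyp (q ^ v) (q ^ k j) *
      (rogers_coeff n v * z ^ v * W I k)) = rogers_multi (I - {j}) n y * pair_sum n (y j) z" if j: "j \<in> I" for j z
  proof -
    have I: "insert j (I - {j}) = I" using j by auto
    have s: "schur (I - {j}) (\<lambda>i. q ^ (k(j := u)) i) = schur (I - {j}) (\<lambda>i. q ^ k i)" for k u
      by (rule schur_cong) auto
    have W: "W I (k(j := u)) = rogers_coeff n u * y j ^ u * W (I - {j}) k" for k u
    proof -
      have "W (I - {j}) (k(j := u)) = W (I - {j}) k"
        unfolding W_def by (rule prod.cong) auto
      then show ?thesis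
        unfolding W_def using prod.remove [OF fin j, of "\<lambda>i. rogers_coeff n ((k(j := u)) i) * y i ^ (k(j := u)) i"]
        by simp
    qed
    have pe: "(\<Sum>k\<in>?K. F k) = (\<Sum>u=0..n. \<Sum>k\<in>(I - {j}) \<rightarrow>\<^sub>E {0..n}. F (k(j := u)))"
      for F :: "(nat \<Rightarrow> nat) \<Rightarrow> complex"
      using sum_PiE_insert [of j "I - {j}" F "{0..n}"] I by simp
    have "(\<Sum>v=0..n. \<Sum>k\<in>?K. schur (I - {j}) (\<lambda>i. q ^ k i) * hyp (q ^ v) (q ^ k j) *
      (rogers_coeff n v * z ^ v * W I k)) = (\<Sum>v=0..n. \<Sum>u=0..n. \<Sum>k\<in>(I - {j}) \<rightarrow>\<^sub>E {0..n}.
        (hyp (q ^ v) (q ^ u) * rogers_coeff n u * rogers_coeff n v * y j ^ u * z ^ v) *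
        (schur (I - {j}) (\<lambda>i. q ^ k i) * W (I - {j}) k))"
      by (simp only: pe s W fun_upd_same) (simp only: mult_ac)
    also have "\<dots> = pair_sum n (y j) z * rogers_multi (I - {j}) n y"
      unfolding pair_sum_def sum_distrib_right unfolding rogers_multi_def sum_distrib_left W_def atLeast0AtMost
      by (rule sum.swap)
    finally show ?thesis by (simp add: mult.commute)
  qed
  have "rogers_multi (insert j0 I) n (y(j0 := z)) =
    (\<Sum>k\<in>?K. C k * W I k) * rogers n z + (\<Sum>j\<in>I. e j * rogers_multi (I - {j}) n y * pair_sum n (y j) z)" for z
  proof -
    have W: "(\<Prod>i\<in>I. rogers_coeff n (k i) * (y(j0 := z)) i ^ k i) = W I k" for k
      unfolding W_def by (rule prod.cong) (use notin in auto)
    have "rogers_multi (insert j0 I) n (y(j0 := z)) = (\<Sum>v=0..n. \<Sum>k\<in>?K.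
        (C k + (\<Sum>j\<in>I. e j * schur (I - {j}) (\<lambda>i. q ^ k i) * hyp (q ^ v) (q ^ k j))) *
        (rogers_coeff n v * z ^ v * W I k))"
      unfolding rogers_multi_insert [OF fin notin] none W by (simp add: C)
    also have "\<dots> = (\<Sum>v=0..n. \<Sum>k\<in>?K. C k * W I k * (rogers_coeff n v * z ^ v)) +
      (\<Sum>v=0..n. \<Sum>k\<in>?K. \<Sum>j\<in>I. e j * (schur (I - {j}) (\<lambda>i. q ^ k i) * hyp (q ^ v) (q ^ k j) *
        (rogers_coeff n v * z ^ v * W I k)))"
      unfolding distrib_right sum_distrib_right sum.distrib by (simp add: mult_ac)
    also have "(\<Sum>v=0..n. \<Sum>k\<in>?K. C k * W I k * (rogers_coeff n v * z ^ v)) = (\<Sum>k\<in>?K. C k * W I k) * rogers n z"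
      unfolding rogers_def sum_product atLeast0AtMost by (rule sum.swap)
    also have "(\<Sum>v=0..n. \<Sum>k\<in>?K. \<Sum>j\<in>I. e j * (schur (I - {j}) (\<lambda>i. q ^ k i) * hyp (q ^ v) (q ^ k j) *
        (rogers_coeff n v * z ^ v * W I k))) =
      (\<Sum>j\<in>I. e j * (\<Sum>v=0..n. \<Sum>k\<in>?K. schur (I - {j}) (\<lambda>i. q ^ k i) * hyp (q ^ v) (q ^ k j) *
        (rogers_coeff n v * z ^ v * W I k)))"
      unfolding sum_distrib_left
      by (subst sum.swap [of _ I ?K], subst sum.swap [of _ I "{0..n}"]) (rule refl)
    also have "(\<Sum>j\<in>I. e j * (\<Sum>v=0..n. \<Sum>k\<in>?K. schur (I - {j}) (\<lambda>i. q ^ k i) * hyp (q ^ v) (q ^ k j) *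
        (rogers_coeff n v * z ^ v * W I k))) = (\<Sum>j\<in>I. e j * rogers_multi (I - {j}) n y * pair_sum n (y j) z)"
      by (intro sum.cong refl) (subst split, assumption, simp only: mult.assoc)
    finally show ?thesis .
  qed
  then show ?thesis
    by (intro exI [of _ "\<Sum>k\<in>?K. C k * W I k"] exI [of _ "\<lambda>j. e j * rogers_multi (I - {j}) n y"] allI)
qed

text \<open>Exchanging \<open>k a\<close> and \<open>k b\<close> changes the sign of each summand.\<close>

lemma rogers_multi_eq_zero:
  assumes fin: "finite I" and ab: "a \<in> I" "b \<in> I" "a \<noteq> b" and y: "y a = y b"
  shows "rogers_multi I n y = 0"
proof -
  let ?\<tau> = "Transposition.transpose a b"
  let ?T = "\<lambda>k. schur I (\<lambda>i. q ^ k i) * (\<Prod>i\<in>I. rogers_coeff n (k i) * y i ^ k i)"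
  have mem: "?\<tau> i \<in> I \<longleftrightarrow> i \<in> I" for i
    using ab by (auto simp: Transposition.transpose_def)
  have bij: "bij_betw ?\<tau> I I"
    using mem by (intro bij_betw_byWitness [where f' = ?\<tau>]) auto
  have fix_y: "y (?\<tau> i) = y i" for i
    using y by (auto simp: Transposition.transpose_def)
  have neg: "?T (k \<circ> ?\<tau>) = - ?T k" for k
  proof -
    have "schur I (\<lambda>i. q ^ (k \<circ> ?\<tau>) i) = - schur I (\<lambda>i. q ^ k i)"
      using schur_swap [OF fin ab, of "\<lambda>i. q ^ k i"] by (simp add: comp_def)
    moreover have "(\<Prod>i\<in>I. rogers_coeff n ((k \<circ> ?\<tau>) i) * y i ^ (k \<circ> ?\<tau>) i) = (\<Prod>i\<in>I. rogers_coeff n (k i) * y i ^ k i)"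
      using prod.reindex_bij_betw [OF bij, of "\<lambda>i. rogers_coeff n (k i) * y i ^ k i"] by (simp add: fix_y)
    ultimately show ?thesis by simp
  qed
  have "rogers_multi I n y = (\<Sum>k\<in>I \<rightarrow>\<^sub>E {0..n}. ?T (k \<circ> ?\<tau>))"
    unfolding rogers_multi_def
    by (rule sum.reindex_bij_witness [of _ "\<lambda>k. k \<circ> ?\<tau>" "\<lambda>k. k \<circ> ?\<tau>"])
      (auto simp: PiE_iff extensional_def mem comp_assoc)
  also have "\<dots> = - rogers_multi I n y"
    unfolding neg rogers_multi_def by (rule sum_negf)
  finally show ?thesis by simp
qed

text \<open>
  Only the index \<open>0\<close> of the last variable contributes. Schur's product then contains a factor
  \<open>hyp 1 (q ^ k i)\<close> for each other variable, which lowers \<open>k i\<close> by one in the weight; and shifting all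
  indices by one does not change Schur's product, which is homogeneous of degree zero.
\<close>

lemma rogers_multi_last_zero:
  assumes fin: "finite I" and j0: "\<And>i. i \<in> I \<Longrightarrow> i < j0" and y0: "y j0 = 0"
  shows "rogers_multi (insert j0 I) (Suc n) y = wt (Suc n) * (\<Prod>i\<in>I. y i) * rogers_multi I n y"
proof -
  have notin: "j0 \<notin> I" using j0 by auto
  have none: "{i \<in> I. j0 < i} = {}" using j0 order_less_asym by blast
  let ?F = "\<lambda>k. schur I (\<lambda>i. q ^ k i) * (\<Prod>i\<in>I. hyp 1 (q ^ k i)) * (\<Prod>i\<in>I. rogers_coeff (Suc n) (k i) * y i ^ k i)"
  have "rogers_multi (insert j0 I) (Suc n) y = (\<Sum>v=0..Suc n. if v = 0 then wt (Suc n) * (\<Sum>k\<in>I \<rightarrow>\<^sub>E {0..Suc n}. ?F k) else 0)"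
    unfolding rogers_multi_insert [OF fin notin] none y0
  proof (rule sum.cong [OF refl])
    fix v assume "v \<in> {0..Suc n}"
    show "(\<Sum>k\<in>I \<rightarrow>\<^sub>E {0..Suc n}. schur I (\<lambda>i. q ^ k i) * ((-1) ^ card {} * (\<Prod>i\<in>I. hyp (q ^ v) (q ^ k i))) *
        (rogers_coeff (Suc n) v * 0 ^ v * (\<Prod>i\<in>I. rogers_coeff (Suc n) (k i) * y i ^ k i))) =
      (if v = 0 then wt (Suc n) * (\<Sum>k\<in>I \<rightarrow>\<^sub>E {0..Suc n}. ?F k) else 0)"
      by (cases "v = 0") (simp_all add: sum_distrib_left rogers_coeff_def [of _ 0] power_0_left mult_ac)
  qed
  also have "\<dots> = wt (Suc n) * (\<Sum>k\<in>I \<rightarrow>\<^sub>E {0..Suc n}. ?F k)"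
    by simp
  also have "(\<Sum>k\<in>I \<rightarrow>\<^sub>E {0..Suc n}. ?F k) = (\<Sum>k\<in>I \<rightarrow>\<^sub>E {1..Suc n}. ?F k)"
  proof (rule sum.mono_neutral_right)
    show "finite (I \<rightarrow>\<^sub>E {0..Suc n})" using fin by (intro finite_PiE) auto
    show "I \<rightarrow>\<^sub>E {1..Suc n} \<subseteq> I \<rightarrow>\<^sub>E {0..Suc n}" by (intro PiE_mono) auto
    show "\<forall>k\<in>(I \<rightarrow>\<^sub>E {0..Suc n}) - (I \<rightarrow>\<^sub>E {1..Suc n}). ?F k = 0"
    proof
      fix k assume k: "k \<in> (I \<rightarrow>\<^sub>E {0..Suc n}) - (I \<rightarrow>\<^sub>E {1..Suc n})"
      then obtain i where "i \<in> I" "k i = 0"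
        by (force simp: PiE_iff)
      then have "(\<Prod>i\<in>I. hyp 1 (q ^ k i)) = 0"
        using fin by (intro prod_zero) (auto intro!: bexI [of _ i])
      then show "?F k = 0" by simp
    qed
  qed
  also have "\<dots> = (\<Sum>k\<in>I \<rightarrow>\<^sub>E {0..n}. (\<Prod>i\<in>I. y i) *
      (schur I (\<lambda>i. q ^ k i) * (\<Prod>i\<in>I. rogers_coeff n (k i) * y i ^ k i)))"
  proof (rule sum.reindex_bij_witness [of _ "\<lambda>k. restrict (\<lambda>i. Suc (k i)) I" "\<lambda>k. restrict (\<lambda>i. k i - 1) I"])
    fix k assume k: "k \<in> I \<rightarrow>\<^sub>E {1..Suc n}"
    have pos: "k i = Suc (k i - 1)" if "i \<in> I" for i
      using k that by (auto simp: PiE_iff)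
    show "restrict (\<lambda>i. Suc (restrict (\<lambda>i. k i - 1) I i)) I = k"
      using k by (intro extensionalityI [of _ I]) (auto simp: PiE_iff pos [symmetric])
    show "restrict (\<lambda>i. k i - 1) I \<in> I \<rightarrow>\<^sub>E {0..n}"
      using k by (auto simp: PiE_iff)
    have hq: "hyp (q * a) (q * b) = hyp a b" for a b
      using q_nonzero by (rule hyp_scale)
    have "schur I (\<lambda>i. q ^ restrict (\<lambda>i. k i - 1) I i) = schur I (\<lambda>i. q * q ^ (k i - 1))"
      unfolding schur_def hq by (intro prod.cong refl) auto
    also have "\<dots> = schur I (\<lambda>i. q ^ k i)"
      by (rule schur_cong) (metis pos power_Suc)
    finally have s: "schur I (\<lambda>i. q ^ restrict (\<lambda>i. k i - 1) I i) = schur I (\<lambda>i. q ^ k i)" .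
    have "(\<Prod>i\<in>I. y i) * (\<Prod>i\<in>I. rogers_coeff n (restrict (\<lambda>i. k i - 1) I i) * y i ^ restrict (\<lambda>i. k i - 1) I i) =
        (\<Prod>i\<in>I. y i * (rogers_coeff n (k i - 1) * y i ^ (k i - 1)))"
      by (simp add: prod.distrib)
    also have "\<dots> = (\<Prod>i\<in>I. hyp 1 (q ^ k i) * (rogers_coeff (Suc n) (k i) * y i ^ k i))"
    proof (rule prod.cong [OF refl])
      fix i assume "i \<in> I"
      then show "y i * (rogers_coeff n (k i - 1) * y i ^ (k i - 1)) = hyp 1 (q ^ k i) * (rogers_coeff (Suc n) (k i) * y i ^ k i)"
        using rogers_coeff_drop_bottom [of n "k i - 1"] pos [of i] by (metis mult.assoc mult.commute power_Suc)
    qed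
    finally show "(\<Prod>i\<in>I. y i) * (schur I (\<lambda>i. q ^ restrict (\<lambda>i. k i - 1) I i) *
        (\<Prod>i\<in>I. rogers_coeff n (restrict (\<lambda>i. k i - 1) I i) * y i ^ restrict (\<lambda>i. k i - 1) I i)) = ?F k"
      unfolding s by (simp add: prod.distrib mult_ac)
  next
    fix k assume k: "k \<in> I \<rightarrow>\<^sub>E {0..n}"
    show "restrict (\<lambda>i. restrict (\<lambda>i. Suc (k i)) I i - 1) I = k"
      using k by (intro extensionalityI [of _ I]) (auto simp: PiE_iff)
    show "restrict (\<lambda>i. Suc (k i)) I \<in> I \<rightarrow>\<^sub>E {1..Suc n}"
      using k by (auto simp: PiE_iff)
  qed
  finally show ?thesis
    unfolding rogers_multi_def by (simp add: sum_distrib_left mult.assoc)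
qed

text \<open>
  Reversal of a \<open>q\<close>-shifted factorial. The sign \<open>(-1) ^ k\<close> is the reason for replacing \<open>x i\<close> by \<open>- x i\<close>.
\<close>

lemma wt_times_qpoch_ratio:
  "k \<le> n \<Longrightarrow> wt n * (qpoch (q powi (- int n)) q k / qpoch (- (q powi (- int n))) q k) = (-1) ^ k * wt (n - k)"
proof (induction k)
  case 0
  show ?case by (simp add: qpoch_def)
next
  case (Suc k)
  define r where "r = q ^ (n - k)"
  have split: "q powi (- int n) * q ^ k = 1 / r"
  proof -
    have "q ^ n = q ^ k * r" unfolding r_def using Suc.prems by (simp flip: power_add)
    then show ?thesis using q_nonzero by (simp add: power_int_minus r_def divide_simps)
  qed
  have r: "r \<noteq> 0" "1 + r \<noteq> 0"
    unfolding r_def using q_nonzero one_plus_power_nonzero by simp_all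
  have step: "(1 - q powi (- int n) * q ^ k) / (1 + q powi (- int n) * q ^ k) = - hyp 1 r"
    unfolding split hyp_def using r by (simp add: divide_simps) (simp add: algebra_simps)
  have w: "wt (n - Suc k) = wt (n - k) * hyp 1 r"
    using wt_Suc [of "n - Suc k"] Suc.prems unfolding r_def by (simp add: Suc_diff_Suc del: power_Suc)
  have "wt n * (qpoch (q powi (- int n)) q (Suc k) / qpoch (- (q powi (- int n))) q (Suc k)) =
    wt n * (qpoch (q powi (- int n)) q k / qpoch (- (q powi (- int n))) q k) *
    ((1 - q powi (- int n) * q ^ k) / (1 + q powi (- int n) * q ^ k))"
    by (simp add: qpoch_def)
  also have "\<dots> = (-1) ^ Suc k * wt (n - Suc k)"
    unfolding step w using Suc by simp
  finally show ?case .
qed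

lemma P_eq_rogers_multi: "P q m n x = rogers_multi {1..m} n (\<lambda>i. - x i)"
proof -
  have schur: "(\<Prod>j=1..m. \<Prod>i=1..<j. (q ^ k j - q ^ k i) / (q ^ k j + q ^ k i)) =
      schur {1..m} (\<lambda>i. q ^ k i)" for k :: "nat \<Rightarrow> nat"
  proof -
    have "{i \<in> {1..m}. i < j} = {1..<j}" if "j \<in> {1..m}" for j using that by auto
    then show ?thesis unfolding schur_def hyp_def by (intro prod.cong refl) simp
  qed
  have weight: "wt n * (qpoch (- q) q l * qpoch (q powi (- int n)) q l /
      (qpoch q q l * qpoch (- (q powi (- int n))) q l) * z ^ l) = rogers_coeff n l * (- z) ^ l"
    if "l \<le> n" for l z
  proof -
    have "wt n * (qpoch (- q) q l * qpoch (q powi (- int n)) q l /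
      (qpoch q q l * qpoch (- (q powi (- int n))) q l) * z ^ l) =
      wt l * (wt n * (qpoch (q powi (- int n)) q l / qpoch (- (q powi (- int n))) q l)) * z ^ l"
      unfolding wt_def [of l] by simp
    also have "\<dots> = rogers_coeff n l * (- z) ^ l"
      unfolding wt_times_qpoch_ratio [OF that] using that by (simp add: rogers_coeff_def power_minus [of z])
    finally show ?thesis .
  qed
  have "qpoch (- q) q n ^ m / qpoch q q n ^ m = (\<Prod>i=1..m. wt n)"
    by (simp add: wt_def power_divide)
  then have norm_const: "qpoch (- q) q n ^ m / qpoch q q n ^ m * (s * prod g {1..m}) = s * (\<Prod>i=1..m. wt n * g i)"
    for s and g :: "nat \<Rightarrow> complex"
    by (simp add: prod.distrib mult_ac)
  show ?thesis
    unfolding P_def rogers_multi_def schur sum_distrib_left norm_const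
    by (intro sum.cong refl arg_cong2 [of _ _ _ _ "(*)"] prod.cong weight) (auto simp: PiE_iff)
qed

lemma P_one_eq_rogers: "P q 1 n (\<lambda>_. x) = rogers n (- x)"
proof -
  have "rogers_multi {1} n (\<lambda>_. - x) = rogers n (- x)"
    using rogers_multi_insert [of "{}" 1 n "\<lambda>_. - x"] by (simp add: rogers_def schur_def atLeast0AtMost)
  then show ?thesis by (simp add: P_eq_rogers_multi)
qed

end

section \<open>The determinant as a function of its last variable\<close>

lemma det_mat_sum:
  "det (mat m m f) = (\<Sum>p | p permutes {0..<m}. signof p * (\<Prod>i=0..<m. f (i, p i)))"
proof -
  have "det (mat m m f) = (\<Sum>p | p permutes {0..<m}. signof p * (\<Prod>i=0..<m. mat m m f $$ (i, p i)))"
    by (rule det_def') simp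
  also have "\<dots> = (\<Sum>p | p permutes {0..<m}. signof p * (\<Prod>i=0..<m. f (i, p i)))"
    by (intro sum.cong refl arg_cong2 [of _ _ _ _ "(*)"] prod.cong) (auto simp: permutes_in_image)
  finally show ?thesis .
qed

lemma det_mat_scale_rows:
  "det (mat m m (\<lambda>(i, j). c i * f i j)) = (\<Prod>i=0..<m. c i) * det (mat m m (\<lambda>(i, j). f i j))"
  for f :: "nat \<Rightarrow> nat \<Rightarrow> 'a::comm_ring_1"
  unfolding det_mat_sum by (simp add: prod.distrib sum_distrib_left mult_ac)

context generic_base
begin

definition rogers_det :: "nat \<Rightarrow> nat \<Rightarrow> (nat \<Rightarrow> complex) \<Rightarrow> complex" where
  "rogers_det n m y = det (mat m m (\<lambda>(i, j). rogers_basis n m j (y (Suc i))))"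

text \<open>
  The cofactors of the last row of \<open>rogers_det n (Suc m)\<close>, written so that they visibly depend only on
  the first \<open>m\<close> variables.
\<close>

definition last_cofactor :: "nat \<Rightarrow> nat \<Rightarrow> nat \<Rightarrow> (nat \<Rightarrow> complex) \<Rightarrow> complex" where
  "last_cofactor n m j y = (-1) ^ (m + j) *
     det (mat m m (\<lambda>(i, l). rogers_basis n (Suc m) (if l < j then l else Suc l) (y (Suc i))))"

lemma rogers_det_expand: "rogers_det n (Suc m) y = (\<Sum>j<Suc m. last_cofactor n m j y * rogers_basis n (Suc m) j (y (Suc m)))"
proof -
  let ?A = "mat (Suc m) (Suc m) (\<lambda>(i, j). rogers_basis n (Suc m) j (y (Suc i)))"
  have "rogers_det n (Suc m) y = (\<Sum>j<Suc m. ?A $$ (m, j) * cofactor ?A m j)"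
    unfolding rogers_det_def by (rule laplace_expansion_row) simp_all
  also have "\<dots> = (\<Sum>j<Suc m. last_cofactor n m j y * rogers_basis n (Suc m) j (y (Suc m)))"
  proof (rule sum.cong [OF refl])
    fix j assume j: "j \<in> {..<Suc m}"
    have "mat_delete ?A m j = mat m m (\<lambda>(i, l). rogers_basis n (Suc m) (if l < j then l else Suc l) (y (Suc i)))"
      using j by (intro eq_matI) (auto simp: mat_delete_def)
    with j show "?A $$ (m, j) * cofactor ?A m j = last_cofactor n m j y * rogers_basis n (Suc m) j (y (Suc m))"
      by (simp add: cofactor_def last_cofactor_def)
  qed
  finally show ?thesis .
qed

lemma last_cofactor_cong: "(\<And>i. i \<in> {1..m} \<Longrightarrow> y i = z i) \<Longrightarrow> last_cofactor n m j y = last_cofactor n m j z"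
  unfolding last_cofactor_def by (intro arg_cong2 [of _ _ _ _ "(*)"] refl arg_cong [of _ _ det] cong_mat) auto

lemma rogers_basis_Suc: "rogers_basis (Suc n) (Suc m) (Suc j) y = - y * rogers_basis n m j y"
proof -
  have "Suc n + Suc m - 1 - 2 * Suc j = n + m - 1 - 2 * j" by simp
  then show ?thesis unfolding rogers_basis_def by simp
qed

text \<open>
  Deleting the first column and the last row and extracting a factor \<open>- y i\<close> from each remaining row
  leaves a matrix of the same kind, with \<open>n\<close> and \<open>m\<close> lowered by one.
\<close>

lemma last_cofactor_0: "last_cofactor (Suc n) m 0 y = (\<Prod>i=1..m. y i) * rogers_det n m y"
proof -
  have "last_cofactor (Suc n) m 0 y = (-1) ^ m * ((\<Prod>i=0..<m. - y (Suc i)) * rogers_det n m y)"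
    unfolding last_cofactor_def rogers_det_def det_mat_scale_rows [symmetric] by (simp add: rogers_basis_Suc)
  also have "(\<Prod>i=0..<m. - y (Suc i)) = (-1) ^ m * (\<Prod>i=1..m. y i)"
    using prod.atLeast1_atMost_eq [of y m] by (simp add: prod_uminus atLeast0LessThan)
  finally show ?thesis by (simp flip: power_add mult.assoc)
qed

text \<open>Evaluation at \<open>0\<close> isolates the component along the first basis function.\<close>

lemma rogers_basis_0: "rogers_basis n (Suc m) j 0 = (if j = 0 then wt (n + m) else 0)"
  by (simp add: rogers_basis_def rogers_0)

lemma rogers_det_last_zero: "y (Suc m) = 0 \<Longrightarrow> rogers_det n (Suc m) y = wt (n + m) * last_cofactor n m 0 y"
  unfolding rogers_det_expand by (simp add: rogers_basis_0 if_distrib [of "\<lambda>u. _ * u"] cong: if_cong)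

lemma rogers_det_eq_zero:
  assumes "a \<in> {1..m}" "b \<in> {1..m}" "a \<noteq> b" "y a = y b"
  shows "rogers_det n m y = 0"
proof -
  let ?A = "mat m m (\<lambda>(i, j). rogers_basis n m j (y (Suc i)))"
  have "row ?A (a - 1) = row ?A (b - 1)"
    using assms by (intro eq_vecI) auto
  then show ?thesis
    unfolding rogers_det_def using assms by (intro det_identical_rows [of ?A m "a - 1" "b - 1"]) auto
qed

text \<open>A nonzero determinant makes the basis functions independent on the points \<open>y 1, \<dots>, y m\<close>.\<close>

lemma rogers_det_nonzero_imp_coeff_zero:
  assumes nz: "rogers_det n m y \<noteq> 0" and z: "\<And>i. i \<in> {1..m} \<Longrightarrow> (\<Sum>j<m. c j * rogers_basis n m j (y i)) = 0"
    and j: "j < m"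
  shows "c j = 0"
proof (rule ccontr)
  let ?A = "mat m m (\<lambda>(i, j). rogers_basis n m j (y (Suc i)))"
  assume "c j \<noteq> 0"
  then have "vec m c \<noteq> 0\<^sub>v m" using j by (metis index_vec index_zero_vec(1))
  moreover have "?A *\<^sub>v vec m c = 0\<^sub>v m"
  proof (rule eq_vecI)
    fix i assume "i < dim_vec (0\<^sub>v m)"
    then have i: "i < m" by simp
    then have "(?A *\<^sub>v vec m c) $ i = (\<Sum>j<m. c j * rogers_basis n m j (y (Suc i)))"
      by (simp add: scalar_prod_def atLeast0LessThan mult.commute)
    with z [of "Suc i"] i show "(?A *\<^sub>v vec m c) $ i = 0\<^sub>v m $ i" by simp
  qed simp
  ultimately have "det ?A = 0"
    by (subst det_0_iff_vec_prod_zero_field [of _ m]) (auto intro!: exI [of _ "vec m c"])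
  with nz show False by (simp add: rogers_det_def)
qed

section \<open>The cleared sum lies in the span\<close>

text \<open>
  Only the factors \<open>1 - y i * y j\<close> that involve the last variable \<open>z\<close> are included: with respect to \<open>z\<close>
  the others are constants.
\<close>

definition cleared :: "nat \<Rightarrow> nat \<Rightarrow> (nat \<Rightarrow> complex) \<Rightarrow> complex \<Rightarrow> complex" where
  "cleared n m y z = (\<Prod>i=1..m. 1 - z * y i) * rogers_multi {1..Suc m} n (y(Suc m := z))"

lemma rogers_in_rogers_space: "rogers n \<in> rogers_space n 1"
  using rogers_space_basis [of 0 1 n] by (simp add: rogers_basis_def [abs_def])

lemma pair_in_rogers_space: "(\<lambda>z. (1 - z * w) * pair_sum (Suc n) w z) \<in> rogers_space (Suc n) 2"
proof -
  have "(1 - z * w) * pair_sum (Suc n) w z =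
    hyp 1 (q ^ Suc (Suc n)) * (w * rogers n w * rogers_basis (Suc n) 2 0 z + rogers (Suc (Suc n)) w * rogers_basis (Suc n) 2 1 z)" for z
    using pair_sum_formula [of w z n] by (simp add: rogers_basis_def mult.commute [of z w] del: power_Suc)
  then show ?thesis
    by (simp only:) (intro rogers_space_scale rogers_space_add rogers_space_basis; simp)
qed

lemma cleared_in_ext_space:
  assumes "m \<le> n"
  shows "cleared n m y \<in> ext_space n (Suc m)"
proof -
  have interval: "{1..Suc m} = insert (Suc m) {1..m}" by auto
  obtain c d where cd: "\<And>z. rogers_multi {1..Suc m} n (y(Suc m := z)) =
      c * rogers n z + (\<Sum>j\<in>{1..m}. d j * pair_sum n (y j) z)"
    using rogers_multi_decomposition [of "{1..m}" "Suc m" n y] unfolding interval by auto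
  have one: "(\<lambda>z. (\<Prod>i\<in>{1..m}. 1 - z * y i) * rogers n z) \<in> ext_space n (Suc m)"
    using ext_space_mult_prod [of "{1..m}" "rogers n" n 1 y] rogers_space_subset_ext_space [OF rogers_in_rogers_space] assms by simp
  have two: "(\<lambda>z. (\<Prod>i\<in>{1..m} - {j}. 1 - z * y i) * ((1 - z * y j) * pair_sum n (y j) z)) \<in> ext_space n (Suc m)"
    if j: "j \<in> {1..m}" for j
  proof -
    have m: "1 \<le> m" using j by simp
    then obtain n' where n: "n = Suc n'" using assms by (cases n) auto
    show ?thesis
      using ext_space_mult_prod [of "{1..m} - {j}" _ n 2 y, OF _ rogers_space_subset_ext_space [OF pair_in_rogers_space [of "y j" n', folded n]]]
        assms j m by (simp add: numeral_2_eq_2)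
  qed
  have "cleared n m y z = c * ((\<Prod>i\<in>{1..m}. 1 - z * y i) * rogers n z) +
      (\<Sum>j\<in>{1..m}. d j * ((\<Prod>i\<in>{1..m} - {j}. 1 - z * y i) * ((1 - z * y j) * pair_sum n (y j) z)))" for z
  proof -
    have "(\<Prod>i\<in>{1..m}. 1 - z * y i) * (\<Sum>j\<in>{1..m}. d j * pair_sum n (y j) z) =
      (\<Sum>j\<in>{1..m}. d j * ((\<Prod>i\<in>{1..m} - {j}. 1 - z * y i) * ((1 - z * y j) * pair_sum n (y j) z)))"
      unfolding sum_distrib_left
    proof (rule sum.cong [OF refl])
      fix j assume "j \<in> {1..m}"
      then have "(\<Prod>i\<in>{1..m}. 1 - z * y i) = (1 - z * y j) * (\<Prod>i\<in>{1..m} - {j}. 1 - z * y i)"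
        by (intro prod.remove) simp_all
      then show "(\<Prod>i\<in>{1..m}. 1 - z * y i) * (d j * pair_sum n (y j) z) =
          d j * ((\<Prod>i\<in>{1..m} - {j}. 1 - z * y i) * ((1 - z * y j) * pair_sum n (y j) z))"
        by (simp only: mult_ac)
    qed
    then show ?thesis
      unfolding cleared_def cd by (simp only: distrib_left mult.left_commute [of _ c])
  qed
  then have "cleared n m y = (\<lambda>z. c * ((\<Prod>i\<in>{1..m}. 1 - z * y i) * rogers n z) +
      (\<Sum>j\<in>{1..m}. d j * ((\<Prod>i\<in>{1..m} - {j}. 1 - z * y i) * ((1 - z * y j) * pair_sum n (y j) z))))"
    by (rule ext)
  also have "\<dots> \<in> ext_space n (Suc m)"
    by (intro ext_space_add ext_space_scale ext_space_sum one two)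
  finally show ?thesis .
qed

lemma cleared_zero: "k \<in> {1..m} \<Longrightarrow> cleared n m y (y k) = 0"
  using rogers_multi_eq_zero [of "{1..Suc m}" k "Suc m" "y(Suc m := y k)" n] by (auto simp: cleared_def)

lemma cleared_zero_inverse: "k \<in> {1..m} \<Longrightarrow> y k \<noteq> 0 \<Longrightarrow> cleared n m y (1 / y k) = 0"
  by (auto simp: cleared_def intro!: prod_zero bexI [of _ k])

text \<open>
  Write the function as \<open>g z + (1 - z) * h z\<close>. Its zeros at \<open>y k\<close> and at \<open>1 / y k\<close>, the latter carried to
  \<open>y k\<close> by the reflection, give \<open>g + (1 - y k) * h = 0\<close> and \<open>g - (1 - y k) * h = 0\<close> at \<open>y k\<close>. Hence
  \<open>h\<close> vanishes at \<open>m\<close> points, and it is a combination of \<open>m\<close> basis functions that are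
  independent on these points.
\<close>

lemma cleared_in_rogers_space:
  assumes mn: "m \<le> n" and nz: "rogers_det n m y \<noteq> 0" and y: "\<And>k. k \<in> {1..m} \<Longrightarrow> y k \<noteq> 0 \<and> y k \<noteq> 1"
  shows "cleared n m y \<in> rogers_space n (Suc m)"
proof -
  obtain g h where g: "g \<in> rogers_space n (Suc m)" and h: "h \<in> rogers_space n m"
    and gh: "\<And>z. cleared n m y z = g z + (1 - z) * h z"
    using cleared_in_ext_space [OF mn, of y] by (auto elim: ext_spaceE)
  have hy: "h (y k) = 0" if k: "k \<in> {1..m}" for k
  proof -
    have y0: "y k \<noteq> 0" and y1: "1 - y k \<noteq> 0" using y [OF k] by auto
    have rg: "y k ^ (n + m) * g (1 / y k) = g (y k)"
      using rogers_space_reflect [OF g _ y0] mn by simp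
    have rh: "y k ^ (n + m - 1) * h (1 / y k) = h (y k)"
      using rogers_space_reflect [OF h _ y0] mn by simp
    have "n + m = Suc (n + m - 1)" using k by auto
    then have p: "y k ^ (n + m) = y k * y k ^ (n + m - 1)" by (metis power_Suc)
    have "0 = y k ^ (n + m) * (g (1 / y k) + (1 - 1 / y k) * h (1 / y k))"
      using cleared_zero_inverse [where k = k and y = y and n = n, OF k y0] gh by simp
    also have "\<dots> = g (y k) + (y k * (1 - 1 / y k)) * (y k ^ (n + m - 1) * h (1 / y k))"
      unfolding distrib_left rg unfolding p by (simp only: mult_ac)
    also have "\<dots> = g (y k) - (1 - y k) * h (y k)"
      unfolding rh using y0 by (simp add: right_diff_distrib left_diff_distrib)
    finally have "g (y k) = (1 - y k) * h (y k)" by simp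
    moreover have "g (y k) + (1 - y k) * h (y k) = 0"
      using cleared_zero [where k = k and y = y and n = n, OF k] gh by simp
    ultimately have "2 * ((1 - y k) * h (y k)) = 0" by (simp only: mult_2)
    then show ?thesis using y1 by simp
  qed
  obtain c where c: "\<And>z. h z = (\<Sum>j<m. c j * rogers_basis n m j z)"
    using h by (rule rogers_spaceE) blast
  have "c j = 0" if "j < m" for j
    using nz _ that by (rule rogers_det_nonzero_imp_coeff_zero) (use hy c in auto)
  then have "h z = 0" for z unfolding c by simp
  then have "cleared n m y = g" using gh by auto
  with g show ?thesis by simp
qed

text \<open>
  The function and the determinant are two elements of the same space with the common zeros \<open>y k\<close>. The
  combination of the two without component along the first basis function is divisible by \<open>z\<close>; the
  quotient lies in the space for \<open>n\<close> and \<open>m\<close> and vanishes at \<open>m\<close> points, so it is zero. The constant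
  of proportionality is read off at \<open>z = 0\<close>.
\<close>

lemma cleared_formula:
  assumes mn: "m \<le> Suc n" and nz: "rogers_det (Suc n) m y \<noteq> 0" "rogers_det n m y \<noteq> 0"
    and y: "\<And>k. k \<in> {1..m} \<Longrightarrow> y k \<noteq> 0 \<and> y k \<noteq> 1"
  shows "wt (Suc n + m) * rogers_det n m y * cleared (Suc n) m y z =
    wt (Suc n) * rogers_multi {1..m} n y * rogers_det (Suc n) (Suc m) (y(Suc m := z))"
proof -
  let ?b = "rogers_basis (Suc n) (Suc m)"
  define C where "C j = last_cofactor (Suc n) m j y" for j
  obtain c where c: "\<And>z. cleared (Suc n) m y z = (\<Sum>j<Suc m. c j * ?b j z)"
    using cleared_in_rogers_space [OF mn nz(1) y] unfolding rogers_space_def by blast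
  have D: "rogers_det (Suc n) (Suc m) (y(Suc m := z)) = (\<Sum>j<Suc m. C j * ?b j z)" for z
  proof -
    have "last_cofactor (Suc n) m j (y(Suc m := z)) = C j" for j
      unfolding C_def by (rule last_cofactor_cong) auto
    then show ?thesis unfolding rogers_det_expand by simp
  qed
  \<comment> \<open>The coefficients of a combination that has no component along the basis function of index 0,
    which is the only one that does not vanish at 0.\<close>
  define e where "e j = C 0 * c j - c 0 * C j" for j
  have comb: "C 0 * cleared (Suc n) m y z - c 0 * rogers_det (Suc n) (Suc m) (y(Suc m := z)) = - z * (\<Sum>j<m. e (Suc j) * rogers_basis n m j z)" for z
  proof -
    have "C 0 * cleared (Suc n) m y z - c 0 * rogers_det (Suc n) (Suc m) (y(Suc m := z)) = (\<Sum>j<Suc m. e j * ?b j z)"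
      unfolding c D e_def sum_distrib_left sum_subtractf [symmetric] by (simp only: left_diff_distrib mult.assoc)
    also have "\<dots> = (\<Sum>j<m. e (Suc j) * ?b (Suc j) z)"
      by (subst sum.lessThan_Suc_shift) (simp add: e_def)
    also have "\<dots> = - z * (\<Sum>j<m. e (Suc j) * rogers_basis n m j z)"
      unfolding rogers_basis_Suc sum_distrib_left by (simp only: mult_ac)
    finally show ?thesis .
  qed
  have "e (Suc j) = 0" if "j < m" for j
  proof (rule rogers_det_nonzero_imp_coeff_zero [OF nz(2) _ that, of "\<lambda>j. e (Suc j)"])
    fix k assume k: "k \<in> {1..m}"
    have "rogers_det (Suc n) (Suc m) (y(Suc m := y k)) = 0"
      using k by (intro rogers_det_eq_zero [of k _ "Suc m"]) auto
    with comb [of "y k"] cleared_zero [where k = k and y = y and n = "Suc n", OF k] y [OF k]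
    show "(\<Sum>j<m. e (Suc j) * rogers_basis n m j (y k)) = 0" by simp
  qed
  then have proportional: "C 0 * cleared (Suc n) m y z = c 0 * rogers_det (Suc n) (Suc m) (y(Suc m := z))"
    using comb [of z] by simp
  have "cleared (Suc n) m y 0 = wt (Suc n) * (\<Prod>i=1..m. y i) * rogers_multi {1..m} n y"
  proof -
    have "{1..Suc m} = insert (Suc m) {1..m}" by auto
    moreover have "(\<Prod>i=1..m. (y(Suc m := 0)) i) = (\<Prod>i=1..m. y i)" by (rule prod.cong) auto
    moreover have "rogers_multi {1..m} n (y(Suc m := 0)) = rogers_multi {1..m} n y" by (rule rogers_multi_cong) auto
    ultimately show ?thesis
      unfolding cleared_def using rogers_multi_last_zero [of "{1..m}" "Suc m" "y(Suc m := 0)" n] by simp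
  qed
  moreover have "cleared (Suc n) m y 0 = c 0 * wt (Suc n + m)"
    unfolding c by (simp add: rogers_basis_0 if_distrib [of "\<lambda>u. _ * u"] cong: if_cong)
  ultimately have c0: "c 0 * wt (Suc n + m) = wt (Suc n) * (\<Prod>i=1..m. y i) * rogers_multi {1..m} n y" by simp
  have Y: "(\<Prod>i=1..m. y i) \<noteq> 0" using y by auto
  have C0: "C 0 = (\<Prod>i=1..m. y i) * rogers_det n m y"
    unfolding C_def by (rule last_cofactor_0)
  have "(\<Prod>i=1..m. y i) * (wt (Suc n + m) * rogers_det n m y * cleared (Suc n) m y z) =
      wt (Suc n + m) * (C 0 * cleared (Suc n) m y z)"
    unfolding C0 by (simp only: mult_ac)
  also have "\<dots> = (c 0 * wt (Suc n + m)) * rogers_det (Suc n) (Suc m) (y(Suc m := z))"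
    unfolding proportional by (simp only: mult_ac)
  also have "\<dots> = (\<Prod>i=1..m. y i) * (wt (Suc n) * rogers_multi {1..m} n y * rogers_det (Suc n) (Suc m) (y(Suc m := z)))"
    unfolding c0 by (simp only: mult_ac)
  finally show ?thesis using Y by simp
qed

end

section \<open>General position and the induction on the number of variables\<close>

definition polyfun :: "(complex \<Rightarrow> complex) \<Rightarrow> bool" where
  "polyfun f \<longleftrightarrow> (\<exists>p. \<forall>s. f s = poly p s)"

lemma polyfun_const: "polyfun (\<lambda>s. c)"
  unfolding polyfun_def by (rule exI [of _ "[:c:]"]) simp

lemma polyfun_id: "polyfun (\<lambda>s. s)"
  unfolding polyfun_def by (rule exI [of _ "[:0, 1:]"]) simp

lemma polyfun_add: "polyfun f \<Longrightarrow> polyfun g \<Longrightarrow> polyfun (\<lambda>s. f s + g s)"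
  unfolding polyfun_def by (metis poly_add)

lemma polyfun_diff: "polyfun f \<Longrightarrow> polyfun g \<Longrightarrow> polyfun (\<lambda>s. f s - g s)"
  unfolding polyfun_def by (metis poly_diff)

lemma polyfun_minus: "polyfun f \<Longrightarrow> polyfun (\<lambda>s. - f s)"
  unfolding polyfun_def by (metis poly_minus)

lemma polyfun_mult: "polyfun f \<Longrightarrow> polyfun g \<Longrightarrow> polyfun (\<lambda>s. f s * g s)"
  unfolding polyfun_def by (metis poly_mult)

lemma polyfun_power: "polyfun f \<Longrightarrow> polyfun (\<lambda>s. f s ^ k)"
  unfolding polyfun_def by (metis poly_power)

lemma polyfun_sum: "(\<And>j. j \<in> J \<Longrightarrow> polyfun (f j)) \<Longrightarrow> polyfun (\<lambda>s. \<Sum>j\<in>J. f j s)"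
  by (induction J rule: infinite_finite_induct) (auto intro: polyfun_const polyfun_add)

lemma polyfun_prod: "(\<And>j. j \<in> J \<Longrightarrow> polyfun (f j)) \<Longrightarrow> polyfun (\<lambda>s. \<Prod>j\<in>J. f j s)"
  by (induction J rule: infinite_finite_induct) (auto intro: polyfun_const polyfun_mult)

lemmas polyfun_intros = polyfun_const polyfun_id polyfun_add polyfun_diff polyfun_minus polyfun_mult
  polyfun_power polyfun_sum polyfun_prod

lemma polyfun_nonroot:
  assumes "polyfun f" "f a \<noteq> 0"
  shows "\<exists>p. p \<noteq> 0 \<and> (\<forall>s. f s = poly p s)"
  using assms unfolding polyfun_def by (metis poly_0)

text \<open>This extends an identity from general position, encoded by \<open>g s \<noteq> 0\<close>, to all points.\<close>

lemma polyfun_mult_eq_zero: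
  assumes f: "polyfun f" and g: "polyfun g" "g a \<noteq> 0" and z: "\<And>s. g s \<noteq> 0 \<Longrightarrow> f s = 0"
  shows "f s = 0"
proof -
  obtain p r where p: "\<And>s. f s = poly p s" and r: "\<And>s. g s = poly r s"
    using f g(1) unfolding polyfun_def by blast
  have "r \<noteq> 0" using g(2) r by auto
  have "poly (p * r) s = 0" for s using z [of s] p r by auto
  then have "p * r = 0" by (metis poly_all_0_iff_0)
  with \<open>r \<noteq> 0\<close> have "p = 0" by simp
  with p show ?thesis by simp
qed

context generic_base
begin

lemma polyfun_rogers_basis: "polyfun f \<Longrightarrow> polyfun (\<lambda>s. rogers_basis n m j (f s))"
  unfolding rogers_basis_def rogers_def by (intro polyfun_intros)

lemma polyfun_rogers_det: "(\<And>i. polyfun (\<lambda>s. w s i)) \<Longrightarrow> polyfun (\<lambda>s. rogers_det n m (w s))"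
  unfolding rogers_det_def det_mat_sum prod.case by (intro polyfun_intros polyfun_rogers_basis)

lemma polyfun_rogers_multi: "(\<And>i. polyfun (\<lambda>s. w s i)) \<Longrightarrow> polyfun (\<lambda>s. rogers_multi I n (w s))"
  unfolding rogers_multi_def by (intro polyfun_intros)

text \<open>
  As a polynomial in its last variable, the determinant has a constant term that is a nonzero multiple
  of the determinant with \<open>n\<close> and \<open>m\<close> lowered by one. One point must serve for several \<open>n\<close> at once,
  since the induction step uses two consecutive values.
\<close>

lemma rogers_det_generic:
  "\<exists>u. (\<forall>i\<in>{1..m}. u i \<noteq> 0 \<and> u i \<noteq> 1) \<and> (\<forall>n\<le>M. m \<le> Suc n \<longrightarrow> rogers_det n m u \<noteq> 0)"
proof (induction m)
  case 0
  show ?case by (simp add: rogers_det_def)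
next
  case (Suc m)
  then obtain u where u: "\<And>i. i \<in> {1..m} \<Longrightarrow> u i \<noteq> 0 \<and> u i \<noteq> 1"
    and rogers_det: "\<And>n. n \<le> M \<Longrightarrow> m \<le> Suc n \<Longrightarrow> rogers_det n m u \<noteq> 0" by blast
  have nz: "rogers_det n (Suc m) (u(Suc m := 0)) \<noteq> 0" if n: "n \<le> M" "m \<le> n" for n
  proof -
    have "last_cofactor n m 0 (u(Suc m := 0)) = last_cofactor n m 0 u"
      by (rule last_cofactor_cong) auto
    moreover have "last_cofactor n m 0 u \<noteq> 0"
    proof (cases n)
      case 0
      with n show ?thesis by (simp add: last_cofactor_def)
    next
      case (Suc n')
      with n rogers_det [of n'] u show ?thesis by (auto simp: last_cofactor_0)
    qed
    ultimately show ?thesis by (simp add: rogers_det_last_zero wt_nonzero)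
  qed
  have pf: "polyfun (\<lambda>z. (u(Suc m := z)) i)" for i
    by (cases "i = Suc m") (simp_all add: polyfun_const polyfun_id)
  have "\<exists>p. p \<noteq> 0 \<and> (\<forall>z. rogers_det n (Suc m) (u(Suc m := z)) = poly p z)" if "n \<in> {m..M}" for n
    using nz [of n] that by (intro polyfun_nonroot [of _ 0] polyfun_rogers_det pf) auto
  then obtain p where p: "\<And>n. n \<in> {m..M} \<Longrightarrow> p n \<noteq> 0"
    and p': "\<And>n z. n \<in> {m..M} \<Longrightarrow> rogers_det n (Suc m) (u(Suc m := z)) = poly (p n) z"
    by metis
  have "(\<Prod>n\<in>{m..M}. p n) * ([:0, 1:] * [:1, -1:]) \<noteq> 0"
    using p by (simp only: mult_eq_0_iff) simp
  then have "finite {z. poly ((\<Prod>n\<in>{m..M}. p n) * ([:0, 1:] * [:1, -1:])) z = 0}"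
    by (rule poly_roots_finite)
  then obtain z where z: "poly ((\<Prod>n\<in>{m..M}. p n) * ([:0, 1:] * [:1, -1:])) z \<noteq> 0"
    using ex_new_if_finite [OF infinite_UNIV_char_0] by (metis (mono_tags, lifting) mem_Collect_eq)
  then have "z \<noteq> 0" "z \<noteq> 1" by auto
  moreover have "rogers_det n (Suc m) (u(Suc m := z)) \<noteq> 0" if "n \<in> {m..M}" for n
    using z that by (auto simp: p' poly_prod)
  moreover have "(u(Suc m := z)) i \<noteq> 0 \<and> (u(Suc m := z)) i \<noteq> 1" if "i \<in> {1..Suc m}" for i
    using u [of i] \<open>z \<noteq> 0\<close> \<open>z \<noteq> 1\<close> that by auto
  ultimately show ?case
    by (intro exI [of _ "u(Suc m := z)"]) (simp del: fun_upd_apply)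
qed

definition norm_const :: "nat \<Rightarrow> nat \<Rightarrow> complex" where
  "norm_const n m = (\<Prod>i=1..m. qpoch (q ^ (n + 1 - m + i)) q (i - 1) / qpoch (- (q ^ (n + 1 - m + i))) q (i - 1))"

lemma wt_ratio: "qpoch (q ^ Suc n) q m / qpoch (- (q ^ Suc n)) q m * wt (n + m) = wt n"
proof (induction m)
  case 0
  show ?case by (simp add: qpoch_def)
next
  case (Suc m)
  have "qpoch (q ^ Suc n) q (Suc m) / qpoch (- (q ^ Suc n)) q (Suc m) * wt (n + Suc m) =
    qpoch (q ^ Suc n) q m / qpoch (- (q ^ Suc n)) q m * (wt (Suc (n + m)) * hyp 1 (q ^ Suc (n + m)))"
    by (simp add: qpoch_def hyp_def power_add mult_ac)
  then show ?case
    unfolding wt_Suc [of "n + m", symmetric] using Suc by simp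
qed

text \<open>The constants satisfy the recursion that evaluation at \<open>z = 0\<close> produces.\<close>

lemma norm_const_Suc: "m \<le> Suc n \<Longrightarrow> norm_const (Suc n) (Suc m) * wt (Suc n + m) = norm_const n m * wt (Suc n)"
proof -
  assume mn: "m \<le> Suc n"
  have "norm_const (Suc n) (Suc m) = norm_const n m * (qpoch (q ^ Suc (Suc n)) q m / qpoch (- (q ^ Suc (Suc n))) q m)"
    unfolding norm_const_def using mn by (simp add: Suc_diff_le del: power_Suc)
  then show ?thesis using wt_ratio [of "Suc n" m] by (simp only: mult.assoc)
qed

definition reflection_prod :: "nat \<Rightarrow> (nat \<Rightarrow> complex) \<Rightarrow> complex" where
  "reflection_prod m y = (\<Prod>j=1..m. \<Prod>i=1..<j. 1 - y i * y j)"

lemma reflection_prod_Suc: "reflection_prod (Suc m) y = reflection_prod m y * (\<Prod>i=1..m. 1 - y (Suc m) * y i)"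
  by (simp add: reflection_prod_def mult.commute atLeastLessThanSuc_atLeastAtMost)

text \<open>
  Where the first \<open>m\<close> variables are in general position, the induction step combines \<open>cleared_formula\<close>
  with the induction hypothesis. An arbitrary point \<open>y\<close> is joined by a line \<open>w\<close> to a point in general
  position, keeping the last variable fixed: along this line the difference \<open>F\<close> of the two sides is
  a polynomial that vanishes wherever the nonzero polynomial \<open>G\<close> does not.
\<close>

lemma rogers_multi_eq_rogers_det:
  "m \<ge> 1 \<Longrightarrow> m \<le> Suc n \<Longrightarrow> reflection_prod m y * rogers_multi {1..m} n y = norm_const n m * rogers_det n m y"
proof (induction m arbitrary: n y rule: nat_induct_at_least)
  case base
  have "rogers_multi {1} n y = rogers n (y 1)"
    using rogers_multi_insert [of "{}" 1 n y] by (simp add: rogers_def schur_def atLeast0AtMost)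
  moreover have "rogers_det n 1 y = rogers n (y 1)"
    unfolding rogers_det_def by (subst det_single) (auto simp: rogers_basis_def)
  ultimately show ?case by (simp add: reflection_prod_def norm_const_def qpoch_def)
next
  case (Suc m)
  from Suc obtain n' where n: "n = Suc n'" by (cases n) auto
  have mn: "m \<le> Suc n'" using Suc.prems n by simp
  obtain u where u: "\<And>i. i \<in> {1..m} \<Longrightarrow> u i \<noteq> 0 \<and> u i \<noteq> 1"
    and rogers_det: "\<And>l. l \<le> n \<Longrightarrow> m \<le> Suc l \<Longrightarrow> rogers_det l m u \<noteq> 0"
    using rogers_det_generic [of m n] by blast
  define w where "w s = (\<lambda>i. if i = Suc m then y i else y i + s * (u i - y i))" for s
  define F where "F s = reflection_prod (Suc m) (w s) * rogers_multi {1..Suc m} n (w s) - norm_const n (Suc m) * rogers_det n (Suc m) (w s)" for s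
  define G where "G s = rogers_det n m (w s) * rogers_det n' m (w s) * (\<Prod>i=1..m. w s i * (1 - w s i))" for s
  have w: "polyfun (\<lambda>s. w s i)" for i
    unfolding w_def by (cases "i = Suc m") (auto intro!: polyfun_intros)
  have F: "polyfun F"
    unfolding F_def reflection_prod_def by (intro polyfun_intros polyfun_rogers_det polyfun_rogers_multi w)
  have G: "polyfun G"
    unfolding G_def by (intro polyfun_intros polyfun_rogers_det w)
  have "F s = 0" if "G s \<noteq> 0" for s
  proof -
    have nz: "rogers_det (Suc n') m (w s) \<noteq> 0" "rogers_det n' m (w s) \<noteq> 0"
      and ws: "\<And>i. i \<in> {1..m} \<Longrightarrow> w s i \<noteq> 0 \<and> w s i \<noteq> 1"
      using that n by (auto simp: G_def)
    let ?z = "w s (Suc m)"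
    have upd: "(w s)(Suc m := ?z) = w s" by simp
    have c: "wt (n + m) * rogers_det n' m (w s) * cleared n m (w s) ?z =
        wt n * rogers_multi {1..m} n' (w s) * rogers_det n (Suc m) (w s)"
      using cleared_formula [OF mn nz ws, of ?z] unfolding upd n .
    have V: "reflection_prod (Suc m) (w s) * rogers_multi {1..Suc m} n (w s) = reflection_prod m (w s) * cleared n m (w s) ?z"
      unfolding reflection_prod_Suc cleared_def upd by (simp only: mult.assoc)
    have IH: "reflection_prod m (w s) * rogers_multi {1..m} n' (w s) = norm_const n' m * rogers_det n' m (w s)"
      by (rule Suc.IH [OF mn])
    have "wt (n + m) * rogers_det n' m (w s) * (reflection_prod m (w s) * cleared n m (w s) ?z) =
      reflection_prod m (w s) * (wt (n + m) * rogers_det n' m (w s) * cleared n m (w s) ?z)"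
      by (simp only: mult_ac)
    also have "\<dots> = (reflection_prod m (w s) * rogers_multi {1..m} n' (w s)) * wt n * rogers_det n (Suc m) (w s)"
      unfolding c by (simp only: mult_ac)
    also have "\<dots> = (norm_const n' m * wt n) * rogers_det n' m (w s) * rogers_det n (Suc m) (w s)"
      unfolding IH by (simp only: mult_ac)
    also have "\<dots> = wt (n + m) * rogers_det n' m (w s) * (norm_const n (Suc m) * rogers_det n (Suc m) (w s))"
      unfolding n norm_const_Suc [OF mn, symmetric] by (simp only: mult_ac)
    finally show ?thesis
      using nz(2) wt_nonzero unfolding F_def V by simp
  qed
  moreover have "G 1 \<noteq> 0"
  proof -
    have w1: "w 1 i = u i" if "i \<in> {1..m}" for i using that by (simp add: w_def)
    have "rogers_det l m (w 1) = rogers_det l m u" for l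
      unfolding rogers_det_def by (intro arg_cong [of _ _ det] cong_mat) (auto simp: w1)
    moreover have "(\<Prod>i=1..m. w 1 i * (1 - w 1 i)) \<noteq> 0" using u by (auto simp: w1)
    ultimately show ?thesis unfolding G_def using rogers_det [of n] rogers_det [of n'] mn n by simp
  qed
  ultimately have "F 0 = 0" using polyfun_mult_eq_zero [OF F G] by blast
  moreover have "w 0 = y" by (auto simp: w_def)
  ultimately show ?case by (simp add: F_def)
qed

end

theorem corollary5p8:
  fixes q :: complex and m n :: nat and x :: "nat \<Rightarrow> complex"
  assumes q_nonzero: "q \<noteq> 0"
    and q_not_root_of_unity: "\<forall>k\<ge>1. q ^ k \<noteq> 1"
    and "m \<ge> 1" and "m \<le> n + 1"
  shows "(\<Prod>j=1..m. \<Prod>i=1..<j. 1 - x i * x j) * P q m n x =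
    (\<Prod>i=1..m. qpoch (q ^ (n + 1 - m + i)) q (i - 1) / qpoch (- (q ^ (n + 1 - m + i))) q (i - 1)) *
    det (mat m m (\<lambda>(i, j). x (i + 1) ^ j * P q 1 (n + m + 1 - 2 * (j + 1)) (\<lambda>_. x (i + 1))))"
proof -
  interpret generic_base q by standard fact+
  have "mat m m (\<lambda>(i, j). x (i + 1) ^ j * P q 1 (n + m + 1 - 2 * (j + 1)) (\<lambda>_. x (i + 1))) =
      mat m m (\<lambda>(i, j). rogers_basis n m j (- x (Suc i)))"
    by (intro cong_mat refl) (simp add: rogers_basis_def P_one_eq_rogers [simplified])
  then show ?thesis
    using rogers_multi_eq_rogers_det [of m n "\<lambda>i. - x i"] assms(3,4)
    by (simp add: P_eq_rogers_multi reflection_prod_def norm_const_def rogers_det_def)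
qed

end
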